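(* Let $0<\alpha<2$, let $(S,\sigma)$ be a finite measure space, let $E$ be a real Banach space, let $u:E\to L_\alpha(S,\sigma)$ be an operator decomposed by a function $\varphi:S\to E'$ with $\|\varphi(s)\|_{E'}\le1$ for all $s\in S$, and let $v:E\to\ell_2$ be the random operator, defined on $(\Delta,\mathbb{Q})$, associated with $u$. For any sequence $(a_n)$ of positive numbers that is regularly varying at infinity, there exists a (non-random) $C\in[0,\infty]$ such that, $\mathbb{Q}$-almost surely, $$\limsup_{n\to\infty}a_n e_n(v)=C.$$ The same holds for the limit inferior; that is, there exists a (non-random) $C'\in[0,\infty]$ such that, $\mathbb{Q}$-almost surely, $\liminf_{n\to\infty}a_ne_n(v)=C'$.
   Context: $E'$ is the topological dual of $E$ with the $\sigma$-field $\mathcal{B}_\sigma(E')$ coming from the weak-$*$ topology. An operator $u:E\to L_\alpha(S,\sigma)$ is decomposed by $\varphi$ if $\varphi:S\to E'$ is $\mathcal{B}_\sigma(E')$-measurable, $\int_S\|\varphi(s)\|_{E'}^\alpha\,d\sigma(s)<\infty$ and $u(z)=\langle z,\varphi\rangle$ for all $z\in E$; one then understands $(uz)(s)=\langle z,\varphi(s)\rangle$. Random operator $v$: on a probability space $(\Delta,\mathbb{Q})$ let $(V_j)_{j\ge1}$ be i.i.d. $S$-valued with law $\sigma/\sigma(S)$, and, independently, let $(\zeta_j)_{j\ge1}$ be i.i.d. standard exponential; put $\Gamma_j:=\zeta_1+\dots+\zeta_j$. With $c_\alpha:=\sqrt2\left(\int_0^\infty x^{-\alpha}\sin x\,dx\right)^{-1/\alpha}(\mathbf{E}|\xi|^\alpha)^{-1/\alpha}$,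 $\xi$ standard normal, set $$v(z):=c_\alpha\,\sigma(S)^{1/\alpha}\left((uz)(V_j)\,\Gamma_j^{-1/\alpha}\right)_{j=1}^\infty,\qquad z\in E,$$ which is $\mathbb{Q}$-a.s. a bounded operator from $E$ to $\ell_2$. It satisfies $e^{-\|u(z)\|_\alpha^\alpha}=\mathbf{E}_{\mathbb{Q}}e^{-\|v(z)\|_2^2}$ for all $z\in E$. Dyadic entropy numbers of an operator $w:E\to F$: $e_n(w):=\inf\{\varepsilon>0\mid\exists y_1,\dots,y_{2^{n-1}}\in F\ \forall z\in E,\|z\|\le1\ \exists i\le2^{n-1}:\ \|w(z)-y_i\|\le\varepsilon\}$.
   Formalization: The formal statement assumes in addition that each e_n(v) is a measurable function (up to null sets) of the sequences (V_j), (ζ_j); this is automatic for separable E, and without it the claim can fail for nonseparable E. *)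

theory Defs
  imports "HOL-Probability.Probability"
begin

section \<open>The sequence space \<open>\<ell>\<^sub>2\<close>\<close>

typedef ell2 = "{x :: nat \<Rightarrow> real. summable (\<lambda>i. (x i)\<^sup>2)}"
  morphisms ell2_nth Abs_ell2
  by (rule exI[of _ "\<lambda>_. 0"]) simp

lemma summable_ell2_square: "summable (\<lambda>i. (ell2_nth x i)\<^sup>2)"
  using ell2_nth[of x] by simp

lemma summable_mult_of_squares:
  fixes f g :: "nat \<Rightarrow> real"
  assumes "summable (\<lambda>i. (f i)\<^sup>2)" "summable (\<lambda>i. (g i)\<^sup>2)"
  shows "summable (\<lambda>i. f i * g i)"
proof (rule summable_comparison_test'[where N = 0])
  show "summable (\<lambda>i. (f i)\<^sup>2 + (g i)\<^sup>2)"
    using assms by (rule summable_add)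
  fix i :: nat
  have "2 * \<bar>f i\<bar> * \<bar>g i\<bar> \<le> (f i)\<^sup>2 + (g i)\<^sup>2"
    using sum_squares_bound[of "\<bar>f i\<bar>" "\<bar>g i\<bar>"] by simp
  moreover have "0 \<le> \<bar>f i\<bar> * \<bar>g i\<bar>" by simp
  ultimately show "norm (f i * g i) \<le> (f i)\<^sup>2 + (g i)\<^sup>2"
    unfolding real_norm_def abs_mult by linarith
qed

lemma summable_square_add:
  fixes f g :: "nat \<Rightarrow> real"
  assumes "summable (\<lambda>i. (f i)\<^sup>2)" "summable (\<lambda>i. (g i)\<^sup>2)"
  shows "summable (\<lambda>i. (f i + g i)\<^sup>2)"
proof -
  have "summable (\<lambda>i. (f i)\<^sup>2 + (g i)\<^sup>2 + 2 * (f i * g i))"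
    by (intro summable_add summable_mult summable_mult_of_squares assms)
  then show ?thesis
    by (simp add: power2_sum mult.assoc)
qed

lemma summable_square_scale:
  fixes f :: "nat \<Rightarrow> real"
  assumes "summable (\<lambda>i. (f i)\<^sup>2)"
  shows "summable (\<lambda>i. (c * f i)\<^sup>2)"
  using summable_mult[OF assms, of "c\<^sup>2"] by (simp add: power_mult_distrib)

instantiation ell2 :: real_inner
begin

definition zero_ell2 :: ell2 where "0 = Abs_ell2 (\<lambda>_. 0)"
definition plus_ell2 :: "ell2 \<Rightarrow> ell2 \<Rightarrow> ell2"
  where "x + y = Abs_ell2 (\<lambda>i. ell2_nth x i + ell2_nth y i)"
definition uminus_ell2 :: "ell2 \<Rightarrow> ell2"
  where "- x = Abs_ell2 (\<lambda>i. - ell2_nth x i)"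
definition minus_ell2 :: "ell2 \<Rightarrow> ell2 \<Rightarrow> ell2"
  where "x - y = Abs_ell2 (\<lambda>i. ell2_nth x i - ell2_nth y i)"
definition scaleR_ell2 :: "real \<Rightarrow> ell2 \<Rightarrow> ell2"
  where "c *\<^sub>R x = Abs_ell2 (\<lambda>i. c * ell2_nth x i)"
definition inner_ell2 :: "ell2 \<Rightarrow> ell2 \<Rightarrow> real"
  where "inner x y = (\<Sum>i. ell2_nth x i * ell2_nth y i)"
definition norm_ell2 :: "ell2 \<Rightarrow> real"
  where "norm x = sqrt (\<Sum>i. (ell2_nth x i)\<^sup>2)"
definition dist_ell2 :: "ell2 \<Rightarrow> ell2 \<Rightarrow> real"
  where "dist_ell2 x y = norm (x - y)"
definition sgn_ell2 :: "ell2 \<Rightarrow> ell2"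
  where "sgn_ell2 x = inverse (norm x) *\<^sub>R x"
definition uniformity_ell2 :: "(ell2 \<times> ell2) filter"
  where "uniformity_ell2 = (INF e\<in>{0 <..}. principal {(x, y). dist x y < e})"
definition open_ell2 :: "ell2 set \<Rightarrow> bool"
  where "open_ell2 U \<longleftrightarrow> (\<forall>x\<in>U. eventually (\<lambda>(x', y). x' = x \<longrightarrow> y \<in> U) uniformity)"

lemma ell2_nth_zero [simp]: "ell2_nth 0 i = 0"
  unfolding zero_ell2_def by (simp add: Abs_ell2_inverse)

lemma ell2_nth_add [simp]: "ell2_nth (x + y) i = ell2_nth x i + ell2_nth y i"
  unfolding plus_ell2_def
  by (simp add: Abs_ell2_inverse summable_square_add summable_ell2_square)

lemma ell2_nth_uminus [simp]: "ell2_nth (- x) i = - ell2_nth x i"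
  unfolding uminus_ell2_def by (simp add: Abs_ell2_inverse summable_ell2_square)

lemma ell2_nth_minus [simp]: "ell2_nth (x - y) i = ell2_nth x i - ell2_nth y i"
proof -
  have "summable (\<lambda>i. (ell2_nth x i - ell2_nth y i)\<^sup>2)"
    using summable_square_add[OF summable_ell2_square[of x] summable_ell2_square[of "- y"]]
    by simp
  then show ?thesis unfolding minus_ell2_def by (simp add: Abs_ell2_inverse)
qed

lemma ell2_nth_scaleR [simp]: "ell2_nth (c *\<^sub>R x) i = c * ell2_nth x i"
  unfolding scaleR_ell2_def
  by (simp add: Abs_ell2_inverse summable_square_scale summable_ell2_square)

lemma ell2_eqI: "(\<And>i. ell2_nth x i = ell2_nth y i) \<Longrightarrow> x = y"
  by (metis ell2_nth_inject ext)

lemma summable_ell2_mult: "summable (\<lambda>i. ell2_nth x i * ell2_nth y i)"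
  by (intro summable_mult_of_squares summable_ell2_square)

instance
proof
  fix x y z :: ell2 and a b :: real
  show "x + y + z = x + (y + z)" "x + y = y + x" "0 + x = x" "- x + x = 0"
    "x - y = x + - y"
    by (auto intro!: ell2_eqI)
  show "a *\<^sub>R (x + y) = a *\<^sub>R x + a *\<^sub>R y" "(a + b) *\<^sub>R x = a *\<^sub>R x + b *\<^sub>R x"
    "a *\<^sub>R b *\<^sub>R x = (a * b) *\<^sub>R x" "1 *\<^sub>R x = x"
    by (auto intro!: ell2_eqI simp: algebra_simps)
  show "dist x y = norm (x - y)" by (rule dist_ell2_def)
  show "sgn x = inverse (norm x) *\<^sub>R x" by (rule sgn_ell2_def)
  show "(uniformity :: (ell2 \<times> ell2) filter) = (INF e\<in>{0 <..}. principal {(x, y). dist x y < e})"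
    by (rule uniformity_ell2_def)
  show "open U \<longleftrightarrow> (\<forall>x\<in>U. \<forall>\<^sub>F (x', y) in uniformity. x' = x \<longrightarrow> y \<in> U)" for U :: "ell2 set"
    by (rule open_ell2_def)
  show "inner x y = inner y x" by (simp add: inner_ell2_def mult.commute)
  show "inner (x + y) z = inner x z + inner y z"
    by (simp add: inner_ell2_def distrib_right suminf_add[symmetric] summable_ell2_mult)
  show "inner (a *\<^sub>R x) y = a * inner x y"
    by (simp add: inner_ell2_def mult.assoc suminf_mult summable_ell2_mult)
  show "0 \<le> inner x x"
    unfolding inner_ell2_def by (intro suminf_nonneg summable_ell2_mult) simp
  show "inner x x = 0 \<longleftrightarrow> x = 0"
  proof
    assume "inner x x = 0"
    then have "\<forall>i. ell2_nth x i * ell2_nth x i = 0"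
      unfolding inner_ell2_def
      by (subst suminf_eq_zero_iff[symmetric]) (auto intro: summable_ell2_mult)
    then show "x = 0" by (intro ell2_eqI) auto
  qed (simp add: inner_ell2_def)
  show "norm x = sqrt (inner x x)"
    by (simp add: norm_ell2_def inner_ell2_def power2_eq_square)
qed

end


section \<open>The weak-\<open>*\<close> topology and operators into \<open>L\<^sub>\<alpha>\<close>\<close>

text \<open>The topological dual of a normed space \<open>'e\<close> is the type \<^typ>\<open>'e \<Rightarrow>\<^sub>L real\<close>, whose norm is the
  operator norm.\<close>

definition weak_star :: "('e::real_normed_vector \<Rightarrow>\<^sub>L real) topology" where
  "weak_star = topology_generated_by {{f. blinfun_apply f z \<in> U} |z U. open U}"

definition weak_star_borel :: "('e::real_normed_vector \<Rightarrow>\<^sub>L real) measure" where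
  "weak_star_borel = sigma UNIV {W. openin weak_star W}"

text \<open>An operator from \<open>'e\<close> to \<open>L\<^sub>\<alpha>(S)\<close> is given by a choice \<open>u z\<close> of a representative of the
  equivalence class for each \<open>z\<close>; linearity therefore holds almost everywhere only.  The bound is
  the bound on the (quasi-)norms, raised to the power \<open>\<alpha>\<close>.\<close>

definition L_alpha_operator ::
  "real \<Rightarrow> 's measure \<Rightarrow> ('e::real_normed_vector \<Rightarrow> 's \<Rightarrow> real) \<Rightarrow> bool" where
  "L_alpha_operator \<alpha> S u \<longleftrightarrow>
     (\<forall>z. u z \<in> borel_measurable S) \<and>
     (\<forall>y z. AE s in S. u (y + z) s = u y s + u z s) \<and>
     (\<forall>c z. AE s in S. u (c *\<^sub>R z) s = c * u z s) \<and>
     (\<exists>K\<ge>0. \<forall>z. (\<integral>\<^sup>+ s. ennreal (\<bar>u z s\<bar> powr \<alpha>) \<partial>S) \<le> ennreal ((K * norm z) powr \<alpha>))"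

text \<open>The identity \<open>u(z) = \<langle>z, \<phi>\<rangle>\<close> is required for the chosen representatives, at every point of
  \<open>S\<close>: the random operator below evaluates \<open>u z\<close> at random points, with
  \<open>(u z)(s) = \<langle>z, \<phi> s\<rangle>\<close>.\<close>

definition decomposed_by ::
  "real \<Rightarrow> 's measure \<Rightarrow> ('e::real_normed_vector \<Rightarrow> 's \<Rightarrow> real) \<Rightarrow> ('s \<Rightarrow> 'e \<Rightarrow>\<^sub>L real) \<Rightarrow> bool" where
  "decomposed_by \<alpha> S u \<phi> \<longleftrightarrow>
     \<phi> \<in> measurable S weak_star_borel \<and>
     (\<integral>\<^sup>+ s. ennreal (norm (\<phi> s) powr \<alpha>) \<partial>S) < \<infinity> \<and>
     (\<forall>z. \<forall>s\<in>space S. u z s = blinfun_apply (\<phi> s) z)"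


section \<open>The random operator\<close>

text \<open>The sine integral is only conditionally convergent for \<open>\<alpha> \<le> 1\<close>; the Henstock--Kurzweil
  integral over the half line is the improper integral.\<close>

definition c_const :: "real \<Rightarrow> real" where
  "c_const \<alpha> = sqrt 2
     * (integral {0..} (\<lambda>x. x powr (- \<alpha>) * sin x)) powr (- 1 / \<alpha>)
     * (\<integral>x. \<bar>x\<bar> powr \<alpha> \<partial>(density lborel std_normal_density)) powr (- 1 / \<alpha>)"

text \<open>\<open>random_operator \<alpha> S u x t\<close> is the operator \<open>v\<close> when \<open>x\<close> and \<open>t\<close> are the realizations of the
  sequences \<open>(V\<^sub>j)\<close> and \<open>(\<zeta>\<^sub>j)\<close>, with indices starting at 0, so that
  \<open>\<Sum>i\<le>j. t i\<close> is \<open>\<Gamma>\<^bsub>j+1\<^esub>\<close>.  The value of \<^const>\<open>Abs_ell2\<close> is unspecified at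
  sequences that are not square summable; this matters on a null set only.\<close>

definition random_operator ::
  "real \<Rightarrow> 's measure \<Rightarrow> ('e \<Rightarrow> 's \<Rightarrow> real) \<Rightarrow> (nat \<Rightarrow> 's) \<Rightarrow> (nat \<Rightarrow> real) \<Rightarrow> 'e \<Rightarrow> ell2" where
  "random_operator \<alpha> S u x t z =
     Abs_ell2 (\<lambda>j. c_const \<alpha> * measure S (space S) powr (1 / \<alpha>)
                    * (u z (x j) * (\<Sum>i\<le>j. t i) powr (- 1 / \<alpha>)))"

text \<open>The law \<open>\<sigma>/\<sigma>(S)\<close> is \<^term>\<open>uniform_measure S (space S)\<close>.\<close>

definition driving_sequences ::
  "'s measure \<Rightarrow> 'd measure \<Rightarrow> (nat \<Rightarrow> 'd \<Rightarrow> 's) \<Rightarrow> (nat \<Rightarrow> 'd \<Rightarrow> real) \<Rightarrow> bool" where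
  "driving_sequences S Q V \<zeta> \<longleftrightarrow>
     prob_space.indep_vars Q (\<lambda>_. S) V UNIV \<and>
     (\<forall>j. distr Q S (V j) = uniform_measure S (space S)) \<and>
     prob_space.indep_vars Q (\<lambda>_. borel) \<zeta> UNIV \<and>
     (\<forall>j. distributed Q lborel (\<zeta> j) (exponential_density 1)) \<and>
     prob_space.indep_set Q
       {(\<lambda>\<omega> j. V j \<omega>) -` A \<inter> space Q |A. A \<in> sets (PiM UNIV (\<lambda>_. S))}
       {(\<lambda>\<omega> j. \<zeta> j \<omega>) -` B \<inter> space Q |B. B \<in> sets (PiM UNIV (\<lambda>_. borel :: real measure))}"

text \<open>The joint law of the two sequences.\<close>

definition driving_law :: "'s measure \<Rightarrow> ((nat \<Rightarrow> 's) \<times> (nat \<Rightarrow> real)) measure" where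
  "driving_law S =
     PiM UNIV (\<lambda>_. uniform_measure S (space S))
       \<Otimes>\<^sub>M PiM UNIV (\<lambda>_. density lborel (exponential_density 1))"


section \<open>Entropy numbers and regular variation\<close>

definition entropy_number ::
  "nat \<Rightarrow> ('e::real_normed_vector \<Rightarrow> 'f::real_normed_vector) \<Rightarrow> real" where
  "entropy_number n w =
     Inf {\<epsilon>. \<exists>y :: nat \<Rightarrow> 'f. \<forall>z. norm z \<le> 1 \<longrightarrow> (\<exists>i<2 ^ (n - 1). norm (w z - y i) \<le> \<epsilon>)}"

text \<open>The entropy numbers of the random operator as measurable functionals of the driving sequences.
  If \<open>'e\<close> is separable this is automatic.  In general it has to be required: let \<open>S = [0,\<omega>\<^sub>1)\<close> carry
  the Dieudonne measure, let \<open>E = C([0,\<omega>\<^sub>1])\<close>, and let \<open>\<phi> s\<close> be evaluation at \<open>s\<close>.  All product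
  measurable sets of full measure contain constant as well as strictly increasing sequences
  \<open>(V\<^sub>j)\<close>; the operator has rank at most one for the former, while for the latter the image of the
  unit ball is dense in a box, so no zero-one law holds.\<close>

definition measurable_entropy_numbers ::
  "real \<Rightarrow> 's measure \<Rightarrow> ('e::real_normed_vector \<Rightarrow> 's \<Rightarrow> real) \<Rightarrow> bool" where
  "measurable_entropy_numbers \<alpha> S u \<longleftrightarrow>
     (\<forall>n\<ge>1. (\<lambda>(x, t). entropy_number n (random_operator \<alpha> S u x t))
               \<in> borel_measurable (completion (driving_law S)))"

definition regularly_varying :: "(nat \<Rightarrow> real) \<Rightarrow> bool" where
  "regularly_varying a \<longleftrightarrow>
     (\<exists>\<rho>. \<forall>l>0. (\<lambda>n. a (nat \<lfloor>l * real n\<rfloor>) / a n) \<longlonglongrightarrow> l powr \<rho>)"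

end

theory Submission
  imports Defs "HOL-Real_Asymp.Real_Asymp"
begin

text \<open>
  The limits superior and inferior of \<open>a\<^sub>n e\<^sub>n(v)\<close> are functions of the driving sequences \<open>(V\<^sub>j, \<zeta>\<^sub>j)\<close>,
  and the claim is a zero-one law: they do not feel a change of finitely many of the pairs
  \<open>(V\<^sub>j, \<zeta>\<^sub>j)\<close>.

  Changing finitely many \<open>V\<^sub>j\<close> changes finitely many coordinates of \<open>v\<close>.  Changing finitely many
  \<open>\<zeta>\<^sub>j\<close> does affect every \<open>\<Gamma>\<^sub>j\<close>, but from some index on by a fixed additive constant; as
  \<open>\<Gamma>\<^sub>j \<rightarrow> \<infinity>\<close>, the far coordinates of \<open>v\<close> are multiplied by factors that tend to \<open>1\<close>.  So for
  each \<open>\<epsilon> > 0\<close> the changed operator \<open>v'\<close> is a bounded operator of rank at most \<open>k\<close> plus \<open>T v\<close> with a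
  diagonal map \<open>T\<close> of norm at most \<open>1 + \<epsilon>\<close>, which yields
  \<open>e\<^bsub>n + p k\<^esub>(v') \<le> (1 + \<epsilon>) e\<^sub>n(v) + K / 2\<^sup>p\<close>
  (\<open>entropy_number_random_operator_tail_perturbation\<close>).  Taking \<open>p\<close> to be a small fraction of \<open>n\<close> makes
  the exponential error negligible against \<open>a\<^sub>n\<close>, which grows at most polynomially, and regular variation
  makes the shift of the index cost only a factor close to \<open>1\<close>
  (\<open>limsup_liminf_le_of_shifted_le\<close>).  By symmetry the limits for \<open>v\<close> and \<open>v'\<close> coincide.

  The entropy numbers are measurable for the completed law only, where an almost sure modification
  destroys exact invariance.  The zero-one law is therefore proved by resampling: all coordinates
  beyond \<open>m\<close> are replaced by an independent copy
  (\<open>zero_one_law_finitely_insensitive_event\<close>).  The operator is well-behaved only when \<open>\<Gamma>\<^sub>j\<close> grows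
  linearly, which holds almost surely (\<open>AE_exponential_partial_sums_grow\<close>).
\<close>

section \<open>Coverings and entropy numbers\<close>

definition covered_by :: "nat \<Rightarrow> real \<Rightarrow> 'a::real_normed_vector set \<Rightarrow> bool" where
  "covered_by N r A \<longleftrightarrow> (\<exists>y :: nat \<Rightarrow> 'a. \<forall>x\<in>A. \<exists>i<N. norm (x - y i) \<le> r)"

lemma entropy_number_eq_Inf_covered:
  "entropy_number n w = Inf {r. covered_by (2 ^ (n - 1)) r (w ` {z. norm z \<le> 1})}"
  unfolding entropy_number_def covered_by_def by simp

lemma covered_by_mono:
  assumes "covered_by N r A" "B \<subseteq> A" "N \<le> M" "r \<le> s"
  shows "covered_by M s B"
  using assms unfolding covered_by_def by (meson order.trans less_le_trans subsetD)

lemma covered_by_nonneg: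
  assumes "covered_by N r A" "A \<noteq> {}"
  shows "0 \<le> r"
  using assms unfolding covered_by_def by (meson norm_ge_zero order.trans ex_in_conv)

lemma covered_by_lipschitz_image:
  assumes "covered_by N r A" and "0 \<le> L" and "\<And>x y. norm (T x - T y) \<le> L * norm (x - y)"
  shows "covered_by N (L * r) (T ` A)"
proof -
  obtain y where y: "\<And>x. x \<in> A \<Longrightarrow> \<exists>i<N. norm (x - y i) \<le> r"
    using assms(1) unfolding covered_by_def by blast
  have "\<exists>i<N. norm (T x - T (y i)) \<le> L * r" if "x \<in> A" for x
    using y[OF that] assms(2,3) by (meson mult_left_mono order.trans)
  then show ?thesis
    unfolding covered_by_def by (intro exI[of _ "\<lambda>i. T (y i)"]) blast
qed

lemma covered_by_sum:
  assumes "covered_by N r A" and "covered_by M s B"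
  shows "covered_by (N * M) (r + s) {x + y |x y. x \<in> A \<and> y \<in> B}"
proof -
  obtain f where f: "\<And>x. x \<in> A \<Longrightarrow> \<exists>i<N. norm (x - f i) \<le> r"
    using assms(1) unfolding covered_by_def by blast
  obtain g where g: "\<And>y. y \<in> B \<Longrightarrow> \<exists>j<M. norm (y - g j) \<le> s"
    using assms(2) unfolding covered_by_def by blast
  define h where "h = (\<lambda>k. f (k div M) + g (k mod M))"
  have "\<exists>k<N * M. norm (x + y - h k) \<le> r + s" if x: "x \<in> A" and y: "y \<in> B" for x y
  proof -
    obtain i j where i: "i < N" "norm (x - f i) \<le> r" and j: "j < M" "norm (y - g j) \<le> s"
      using f[OF x] g[OF y] by blast
    have "i * M + j < N * M"
    proof -
      have "i * M + j < Suc i * M" using j(1) by simp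
      also have "\<dots> \<le> N * M" using i(1) by (intro mult_le_mono1) simp
      finally show ?thesis .
    qed
    moreover have "norm (x + y - h (i * M + j)) \<le> r + s"
      using norm_triangle_mono[OF i(2) j(2)] j(1) by (simp add: h_def algebra_simps)
    ultimately show ?thesis by blast
  qed
  then show ?thesis
    unfolding covered_by_def by (intro exI[of _ h]) auto
qed

text \<open>Bisection: the segment of half-length \<open>K\<close> lies in the sum of the two points \<open>\<plusminus>(K/2) e\<close> and the
  segment of half-length \<open>K/2\<close>, so each doubling of the number of centres halves the radius.\<close>

lemma covered_by_segment:
  fixes e :: "'a::real_normed_vector"
  assumes "0 \<le> K" "norm e \<le> 1"
  shows "covered_by (2 ^ p) (K / 2 ^ p) {c *\<^sub>R e |c. \<bar>c\<bar> \<le> K}"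
  using assms(1)
proof (induction p arbitrary: K)
  case 0
  have "norm (c *\<^sub>R e - 0) \<le> K" if "\<bar>c\<bar> \<le> K" for c
    using mult_mono[OF that assms(2)] \<open>0 \<le> K\<close> by simp
  then show ?case
    unfolding covered_by_def by (auto intro!: exI[of _ "\<lambda>_. 0"])
next
  case (Suc p)
  define y where "y i = (if i = 0 then - (K / 2) else K / 2) *\<^sub>R e" for i :: nat
  have "covered_by 2 0 {y 0, y 1}"
    unfolding covered_by_def by (intro exI[of _ y]) (auto intro: exI[of _ 0] exI[of _ 1])
  moreover have "covered_by (2 ^ p) (K / 2 / 2 ^ p) {c *\<^sub>R e |c. \<bar>c\<bar> \<le> K / 2}"
    using Suc.IH[of "K / 2"] Suc.prems by simp
  ultimately have *: "covered_by (2 * 2 ^ p) (0 + K / 2 / 2 ^ p)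
      {x + z |x z. x \<in> {y 0, y 1} \<and> z \<in> {c *\<^sub>R e |c. \<bar>c\<bar> \<le> K / 2}}"
    by (rule covered_by_sum)
  have "c *\<^sub>R e \<in> {x + z |x z. x \<in> {y 0, y 1} \<and> z \<in> {c *\<^sub>R e |c. \<bar>c\<bar> \<le> K / 2}}"
    if "\<bar>c\<bar> \<le> K" for c
  proof (cases "c \<le> 0")
    case True
    then have "\<bar>c + K / 2\<bar> \<le> K / 2"
      using that by linarith
    moreover have "c *\<^sub>R e = y 0 + (c + K / 2) *\<^sub>R e"
      by (simp add: y_def algebra_simps)
    ultimately show ?thesis by blast
  next
    case False
    then have "\<bar>c - K / 2\<bar> \<le> K / 2"
      using that by linarith
    moreover have "c *\<^sub>R e = y 1 + (c - K / 2) *\<^sub>R e"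
      by (simp add: y_def algebra_simps)
    ultimately show ?thesis by blast
  qed
  then show ?case
    by (intro covered_by_mono[OF *]) auto
qed

text \<open>A bounded set of dimension \<open>k\<close> has exponentially decaying covering radii; this decay is what makes
  a finite-rank change of an operator invisible at polynomial scales.\<close>

lemma covered_by_box:
  fixes e :: "nat \<Rightarrow> 'a::real_normed_vector"
  assumes "0 \<le> K" "\<And>j. norm (e j) \<le> 1"
  shows "covered_by (2 ^ (p * k)) (real k * (K / 2 ^ p)) {(\<Sum>j<k. c j *\<^sub>R e j) |c. \<forall>j<k. \<bar>c j\<bar> \<le> K}"
proof (induction k)
  case 0
  show ?case unfolding covered_by_def by (auto intro!: exI[of _ "\<lambda>_. 0"])
next
  case (Suc k)
  let ?S = "{x + y |x y. x \<in> {(\<Sum>j<k. c j *\<^sub>R e j) |c. \<forall>j<k. \<bar>c j\<bar> \<le> K}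
      \<and> y \<in> {c *\<^sub>R e k |c. \<bar>c\<bar> \<le> K}}"
  have *: "covered_by (2 ^ (p * k) * 2 ^ p) (real k * (K / 2 ^ p) + K / 2 ^ p) ?S"
    by (rule covered_by_sum[OF Suc covered_by_segment[OF assms]])
  have "{(\<Sum>j<Suc k. c j *\<^sub>R e j) |c. \<forall>j<Suc k. \<bar>c j\<bar> \<le> K} \<subseteq> ?S"
  proof clarsimp
    fix c :: "nat \<Rightarrow> real" assume "\<forall>j<Suc k. \<bar>c j\<bar> \<le> K"
    then show "\<exists>x y. (\<Sum>j<k. c j *\<^sub>R e j) + c k *\<^sub>R e k = x + y \<and>
        (\<exists>c. x = (\<Sum>j<k. c j *\<^sub>R e j) \<and> (\<forall>j<k. \<bar>c j\<bar> \<le> K)) \<and> (\<exists>c. y = c *\<^sub>R e k \<and> \<bar>c\<bar> \<le> K)"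
      by (intro exI[of _ "\<Sum>j<k. c j *\<^sub>R e j"] exI[of _ "c k *\<^sub>R e k"] conjI exI[of _ c] exI[of _ "c k"])
        auto
  qed
  then show ?case
    by (rule covered_by_mono[OF *]) (auto simp: power_add algebra_simps add_divide_distrib)
qed

lemma covered_radii_of_bounded:
  fixes w :: "'e::real_normed_vector \<Rightarrow> 'f::real_normed_vector"
  assumes "\<And>z. norm z \<le> 1 \<Longrightarrow> norm (w z) \<le> R"
  shows "R \<in> {r. covered_by (2 ^ n) r (w ` {z. norm z \<le> 1})}"
    and "bdd_below {r. covered_by (2 ^ n) r (w ` {z. norm z \<le> 1})}"
proof -
  show "R \<in> {r. covered_by (2 ^ n) r (w ` {z. norm z \<le> 1})}"
    using assms unfolding covered_by_def by (auto intro!: exI[of _ "\<lambda>_. 0"] exI[of _ 0])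
  have "w 0 \<in> w ` {z. norm z \<le> 1}" by simp
  then show "bdd_below {r. covered_by (2 ^ n) r (w ` {z. norm z \<le> 1})}"
    using covered_by_nonneg by (intro bdd_belowI[of _ 0]) blast
qed

lemma entropy_number_nonneg:
  fixes w :: "'e::real_normed_vector \<Rightarrow> 'f::real_normed_vector"
  assumes "\<And>z. norm z \<le> 1 \<Longrightarrow> norm (w z) \<le> R"
  shows "0 \<le> entropy_number n w"
proof -
  have "w 0 \<in> w ` {z. norm z \<le> 1}" by simp
  then show ?thesis
    unfolding entropy_number_eq_Inf_covered
    using covered_radii_of_bounded(1)[where w = w, OF assms] covered_by_nonneg
    by (intro cInf_greatest; blast)
qed

lemma entropy_number_antimono:
  fixes w :: "'e::real_normed_vector \<Rightarrow> 'f::real_normed_vector"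
  assumes "\<And>z. norm z \<le> 1 \<Longrightarrow> norm (w z) \<le> R" and "n \<le> m"
  shows "entropy_number m w \<le> entropy_number n w"
  unfolding entropy_number_eq_Inf_covered
proof (rule cInf_superset_mono)
  show "{r. covered_by (2 ^ (n - 1)) r (w ` {z. norm z \<le> 1})} \<noteq> {}"
    using covered_radii_of_bounded(1)[where w = w, OF assms(1)] by blast
  show "bdd_below {r. covered_by (2 ^ (m - 1)) r (w ` {z. norm z \<le> 1})}"
    by (rule covered_radii_of_bounded(2)[where w = w, OF assms(1)])
  show "{r. covered_by (2 ^ (n - 1)) r (w ` {z. norm z \<le> 1})}
      \<subseteq> {r. covered_by (2 ^ (m - 1)) r (w ` {z. norm z \<le> 1})}"
    using \<open>n \<le> m\<close> by (auto intro: covered_by_mono simp: power_increasing)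
qed

text \<open>Cover the finite-rank part by \<open>2 ^ (p * k)\<close> balls and the image under \<open>T\<close> of an optimal cover of
  \<open>w\<close>; the sums of the centres cover \<open>w'\<close>.\<close>

lemma entropy_number_finite_rank_perturbation:
  fixes w w' :: "'e::real_normed_vector \<Rightarrow> 'f::real_normed_vector"
  assumes w': "\<And>z. norm z \<le> 1 \<Longrightarrow> w' z = (\<Sum>j<k. c z j *\<^sub>R e j) + T (w z)"
    and c: "\<And>z j. norm z \<le> 1 \<Longrightarrow> j < k \<Longrightarrow> \<bar>c z j\<bar> \<le> K" and e: "\<And>j. norm (e j) \<le> 1" and K: "0 \<le> K"
    and T: "\<And>x y. norm (T x - T y) \<le> L * norm (x - y)" and L: "0 < L"
    and bounded: "\<And>z. norm z \<le> 1 \<Longrightarrow> norm (w z) \<le> R"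
      "\<And>z. norm z \<le> 1 \<Longrightarrow> norm (w' z) \<le> R'"
    and n: "1 \<le> n"
  shows "entropy_number (n + p * k) w' \<le> L * entropy_number n w + real k * K / 2 ^ p"
proof -
  let ?B = "{z :: 'e. norm z \<le> 1}"
  let ?P = "{(\<Sum>j<k. c j *\<^sub>R e j) |c. \<forall>j<k. \<bar>c j\<bar> \<le> K}"
  \<comment> \<open>An entropy number is an infimum that need not be attained, so the bound is shown for each
    admissible radius of the unperturbed operator.\<close>
  have "(entropy_number (n + p * k) w' - real k * K / 2 ^ p) / L \<le> r"
    if r: "covered_by (2 ^ (n - 1)) r (w ` ?B)" for r
  proof -
    have *: "covered_by (2 ^ (p * k) * 2 ^ (n - 1)) (real k * (K / 2 ^ p) + L * r)
        {x + y |x y. x \<in> ?P \<and> y \<in> T ` w ` ?B}"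
      using L by (intro covered_by_sum covered_by_box K e covered_by_lipschitz_image[OF r] T) simp
    have "w' ` ?B \<subseteq> {x + y |x y. x \<in> ?P \<and> y \<in> T ` w ` ?B}"
    proof (rule image_subsetI)
      fix z :: 'e assume "z \<in> ?B"
      then have "norm z \<le> 1" by simp
      have "(\<Sum>j<k. c z j *\<^sub>R e j) \<in> ?P" using c[OF \<open>norm z \<le> 1\<close>] by blast
      moreover have "T (w z) \<in> T ` w ` ?B" using \<open>z \<in> ?B\<close> by blast
      ultimately show "w' z \<in> {x + y |x y. x \<in> ?P \<and> y \<in> T ` w ` ?B}"
        using w'[OF \<open>norm z \<le> 1\<close>] by blast
    qed
    then have "covered_by (2 ^ (n + p * k - 1)) (real k * (K / 2 ^ p) + L * r) (w' ` ?B)"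
      using n by (intro covered_by_mono[OF *]) (auto simp: power_add[symmetric] add.commute)
    then have "entropy_number (n + p * k) w' \<le> real k * (K / 2 ^ p) + L * r"
      unfolding entropy_number_eq_Inf_covered
      by (intro cInf_lower covered_radii_of_bounded(2)[where w = "w'", OF bounded(2)]) auto
    then show ?thesis using L by (simp add: pos_divide_le_eq algebra_simps)
  qed
  then have "(entropy_number (n + p * k) w' - real k * K / 2 ^ p) / L \<le> entropy_number n w"
    unfolding entropy_number_eq_Inf_covered[of n w]
    using covered_radii_of_bounded(1)[where w = w, OF bounded(1)] by (intro cInf_greatest) blast+
  then show ?thesis using L by (simp add: pos_divide_le_eq algebra_simps)
qed

section \<open>Regularly varying sequences\<close>

text \<open>The ratio at \<open>l = 1/2\<close> has a positive limit, so \<open>a n\<close> is at most \<open>2 ^ b\<close> times \<open>a (n div 2)\<close> for large \<open>n\<close>,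
  and halving reaches the finitely many small indices after about \<open>log 2 n\<close> steps.\<close>

lemma regularly_varying_polynomially_bounded:
  fixes a :: "nat \<Rightarrow> real"
  assumes pos: "\<And>n. 0 < a n" and "regularly_varying a"
  obtains C :: real and b :: nat where "0 < C" "\<And>n. 1 \<le> n \<Longrightarrow> a n \<le> C * real n ^ b"
proof -
  obtain \<rho> where "\<forall>l>0. (\<lambda>n. a (nat \<lfloor>l * real n\<rfloor>) / a n) \<longlonglongrightarrow> l powr \<rho>"
    using assms(2) unfolding regularly_varying_def by blast
  then have "(\<lambda>n. a (nat \<lfloor>(1/2) * real n\<rfloor>) / a n) \<longlonglongrightarrow> (1/2) powr \<rho>"
    by (elim allE[of _ "1/2"] impE) simp
  moreover have half: "nat \<lfloor>(1/2) * real n\<rfloor> = n div 2" for n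
    using floor_divide_of_nat_eq[of n 2, where 'a = real] by simp
  ultimately have lim: "(\<lambda>n. a (n div 2) / a n) \<longlonglongrightarrow> (1/2) powr \<rho>" by simp
  define q where "q = (1/2) powr \<rho> / 2"
  have "0 < q" "q < (1/2) powr \<rho>" by (auto simp: q_def)
  from order_tendstoD(1)[OF lim this(2)]
  obtain N where N: "\<And>n. N \<le> n \<Longrightarrow> q < a (n div 2) / a n"
    unfolding eventually_sequentially by blast
  obtain b :: nat where b: "1 / q < 2 ^ b"
    using real_arch_pow[of 2 "1 / q"] by auto
  define C where "C = (\<Sum>n\<le>N + 2. a n)"
  have "0 < C" unfolding C_def by (intro sum_pos pos) auto
  have bound: "a n \<le> C * real n ^ b" if "1 \<le> n" for n
    using that
  proof (induction n rule: less_induct)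
    case (less n)
    show ?case
    proof (cases "n \<le> N + 2")
      case True
      then have "a n \<le> C" unfolding C_def
        using pos by (intro member_le_sum) (auto intro: less_imp_le)
      also have "C * 1 \<le> C * real n ^ b"
        using \<open>0 < C\<close> less.prems by (intro mult_left_mono) auto
      finally show ?thesis by simp
    next
      case False
      have "a n \<le> (1 / q) * a (n div 2)"
        using N[of n] False pos[of n] \<open>0 < q\<close> by (simp add: field_simps)
      also have "\<dots> \<le> 2 ^ b * a (n div 2)"
        using b pos[of "n div 2"] by (intro mult_right_mono) auto
      also have "a (n div 2) \<le> C * real (n div 2) ^ b"
        using False by (intro less.IH) auto
      also have "\<dots> \<le> C * (real n / 2) ^ b"
        using \<open>0 < C\<close> of_nat_div_le_of_nat[of n 2, where 'a = real] by (intro mult_left_mono power_mono) auto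
      finally show ?thesis by (simp add: power_divide)
    qed
  qed
  show ?thesis by (rule that[OF \<open>0 < C\<close> bound])
qed

lemma regularly_varying_times_exponential_tendsto_0:
  fixes a :: "nat \<Rightarrow> real"
  assumes pos: "\<And>n. 0 < a n" and "regularly_varying a" and "0 < \<theta>"
  shows "(\<lambda>n. a n / 2 ^ nat \<lfloor>\<theta> * real n\<rfloor>) \<longlonglongrightarrow> 0"
proof -
  obtain C b where C: "0 < C" and bound: "\<And>n. 1 \<le> n \<Longrightarrow> a n \<le> C * real n ^ b"
    using regularly_varying_polynomially_bounded[OF assms(1,2)] by blast
  have le: "a n / 2 ^ nat \<lfloor>\<theta> * real n\<rfloor> \<le> C * real n ^ b * 2 powr (1 - \<theta> * real n)" if "1 \<le> n" for n
  proof -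
    have "inverse (2 ^ nat \<lfloor>\<theta> * real n\<rfloor>) = 2 powr (- real (nat \<lfloor>\<theta> * real n\<rfloor>))"
      by (simp add: powr_minus powr_realpow)
    also have "\<dots> \<le> 2 powr (1 - \<theta> * real n)"
      by (intro powr_mono) linarith+
    finally have "inverse (2 ^ nat \<lfloor>\<theta> * real n\<rfloor>) \<le> 2 powr (1 - \<theta> * real n)" .
    from mult_mono[OF bound[OF that] this] show ?thesis
      using C by (simp add: divide_inverse)
  qed
  have upper: "(\<lambda>n. C * real n ^ b * 2 powr (1 - \<theta> * real n)) \<longlonglongrightarrow> 0"
  proof -
    define c where "c = \<theta> * ln 2"
    have "0 < c" using \<open>0 < \<theta>\<close> by (simp add: c_def)
    have "filterlim (\<lambda>n. c * real n) at_top sequentially"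
      using \<open>0 < c\<close> by real_asymp
    then have "(\<lambda>n. 2 * C / c ^ b * ((c * real n) ^ b / exp (c * real n))) \<longlonglongrightarrow> 2 * C / c ^ b * 0"
      by (intro tendsto_intros filterlim_compose[OF tendsto_power_div_exp_0])
    moreover have "2 * C / c ^ b * ((c * real n) ^ b / exp (c * real n))
        = C * real n ^ b * 2 powr (1 - \<theta> * real n)" for n
    proof -
      have "2 powr (1 - \<theta> * real n) = 2 / 2 powr (\<theta> * real n)"
        by (simp add: powr_diff)
      also have "2 powr (\<theta> * real n) = exp (c * real n)"
        unfolding powr_def c_def by (simp add: mult.assoc mult.commute[of "ln 2"])
      finally have eq: "2 powr (1 - \<theta> * real n) = 2 / exp (c * real n)" .
      show ?thesis
        unfolding eq power_mult_distrib using \<open>0 < c\<close> by simp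
    qed
    ultimately show ?thesis by simp
  qed
  have "\<forall>\<^sub>F n in sequentially. 0 \<le> a n / 2 ^ nat \<lfloor>\<theta> * real n\<rfloor>"
    using pos by (auto intro!: always_eventually less_imp_le)
  moreover have "\<forall>\<^sub>F n in sequentially.
      a n / 2 ^ nat \<lfloor>\<theta> * real n\<rfloor> \<le> C * real n ^ b * 2 powr (1 - \<theta> * real n)"
    using le by (rule eventually_sequentiallyI)
  ultimately show ?thesis
    by (rule tendsto_sandwich[OF _ _ tendsto_const upper])
qed

text \<open>For \<open>l < 1\<close> the map \<open>n \<mapsto> \<lfloor>l n\<rfloor>\<close> hits every natural number, so that sampling along it loses
  nothing; for the limit inferior this surjectivity is essential.\<close>

lemma filtermap_floor_sequentially:
  assumes "0 < l" "l < (1::real)"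
  shows "filtermap (\<lambda>n. nat \<lfloor>l * real n\<rfloor>) sequentially = sequentially"
proof (rule antisym)
  have "filterlim (\<lambda>n. nat \<lfloor>l * real n\<rfloor>) at_top sequentially"
    using assms(1) by real_asymp
  then show "filtermap (\<lambda>n. nat \<lfloor>l * real n\<rfloor>) sequentially \<le> sequentially"
    by (simp add: filterlim_def)
  show "sequentially \<le> filtermap (\<lambda>n. nat \<lfloor>l * real n\<rfloor>) sequentially"
  proof (rule filter_leI)
    fix P assume "eventually P (filtermap (\<lambda>n. nat \<lfloor>l * real n\<rfloor>) sequentially)"
    then obtain N where N: "\<And>n. N \<le> n \<Longrightarrow> P (nat \<lfloor>l * real n\<rfloor>)"
      unfolding eventually_filtermap eventually_sequentially by blast
    have "P n" if "N \<le> n" for n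
    proof -
      define k where "k = nat \<lceil>real n / l\<rceil>"
      have k: "real n / l \<le> real k" "real k < real n / l + 1"
        unfolding k_def using assms(1) by (auto, linarith)
      have "real n \<le> l * real k" using k(1) assms(1) by (simp add: field_simps)
      moreover have "l * real k < real n + 1"
      proof -
        have "l * real k < l * (real n / l + 1)" using k(2) assms(1) by (intro mult_strict_left_mono)
        also have "\<dots> = real n + l" using assms(1) by (simp add: field_simps)
        finally show ?thesis using assms(2) by simp
      qed
      ultimately have "nat \<lfloor>l * real k\<rfloor> = n" by linarith
      moreover have "real n \<le> real k"
      proof -
        have "real n \<le> real n / l" using assms by (simp add: pos_le_divide_eq mult_left_le)
        then show ?thesis using k(1) by simp
      qed
      ultimately show ?thesis using N[of k] that by simp
    qed
    then show "eventually P sequentially" unfolding eventually_sequentially by blast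
  qed
qed

lemma Liminf_comp_le_Liminf_filtermap:
  fixes g :: "'b \<Rightarrow> 'c::complete_lattice"
  shows "Liminf F (\<lambda>x. g (f x)) \<le> Liminf (filtermap f F) g"
  unfolding Liminf_def
proof (rule SUP_least)
  fix P assume "P \<in> {P. eventually P F}"
  then have "eventually (\<lambda>y. \<exists>x. P x \<and> y = f x) (filtermap f F)"
    by (auto simp: eventually_filtermap elim: eventually_mono)
  moreover have "(INF x\<in>Collect P. g (f x)) \<le> (INF y\<in>{y. \<exists>x. P x \<and> y = f x}. g y)"
    by (rule INF_greatest) (auto intro: INF_lower)
  ultimately show "(INF x\<in>Collect P. g (f x)) \<le> (SUP P\<in>{P. eventually P (filtermap f F)}. INF y\<in>Collect P. g y)"
    by (intro SUP_upper2) auto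
qed

lemma ereal_le_of_scaled_le:
  fixes x y :: ereal
  assumes "\<And>\<delta>. 0 < \<delta> \<Longrightarrow> \<delta> < 1 \<Longrightarrow> x \<le> ereal (f \<delta>) * y"
    and "0 \<le> y" and lim: "(f \<longlongrightarrow> 1) (at_right (0::real))"
  shows "x \<le> y"
proof (cases y)
  case (real r)
  have "((\<lambda>\<delta>. ereal (f \<delta> * r)) \<longlongrightarrow> ereal (1 * r)) (at_right 0)"
    by (intro tendsto_intros lim tendsto_ereal)
  then have "((\<lambda>\<delta>. ereal (f \<delta>) * y) \<longlongrightarrow> y) (at_right 0)"
    by (simp add: real)
  moreover have "\<forall>\<^sub>F \<delta> in at_right (0::real). x \<le> ereal (f \<delta>) * y"
    by (rule eventually_mono[OF eventually_at_right_real[of 0 1]]) (auto intro: assms(1))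
  ultimately show ?thesis
    by (intro tendsto_lowerbound) auto
qed (use assms(2) in auto)

text \<open>Spend the fraction \<open>1 - l\<close> of the index \<open>n\<close> on the shift: with \<open>m = \<lfloor>l n\<rfloor>\<close> and \<open>p\<close> proportional to
  \<open>n\<close>, the hypothesis gives
  \<open>a n * e' n \<le> (1 + \<epsilon>) (a n / a m) (a m * e m) + o(1)\<close>,
  where \<open>a n / a m\<close> tends to \<open>l powr (- \<rho>)\<close> by regular variation and the error \<open>a n * K / 2 ^ p\<close>
  vanishes because \<open>a\<close> grows at most polynomially.  Finally \<open>l \<rightarrow> 1\<close> and \<open>\<epsilon> \<rightarrow> 0\<close> together.\<close>

lemma limsup_liminf_le_of_shifted_le:
  fixes a e e' :: "nat \<Rightarrow> real"
  assumes pos: "\<And>n. 0 < a n" and rv: "regularly_varying a"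
    and nonneg: "\<And>n. 0 \<le> e n" and anti: "\<And>n m. n \<le> m \<Longrightarrow> e' m \<le> e' n"
    and shift: "\<And>\<epsilon>. 0 < \<epsilon> \<Longrightarrow> \<exists>K k. \<forall>n\<ge>1. \<forall>p. e' (n + p * k) \<le> (1 + \<epsilon>) * e n + K / 2 ^ p"
  shows "limsup (\<lambda>n. ereal (a n * e' n)) \<le> limsup (\<lambda>n. ereal (a n * e n))"
    and "liminf (\<lambda>n. ereal (a n * e' n)) \<le> liminf (\<lambda>n. ereal (a n * e n))"
proof -
  obtain \<rho> where \<rho>: "\<And>l. 0 < l \<Longrightarrow> (\<lambda>n. a (nat \<lfloor>l * real n\<rfloor>) / a n) \<longlonglongrightarrow> l powr \<rho>"
    using rv unfolding regularly_varying_def by blast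
  define f where "f \<delta> = (1 + \<delta>) * (1 - \<delta>) powr (- \<rho>)" for \<delta> :: real
  define b where "b n = ereal (a n * e n)" for n
  have "limsup (\<lambda>n. ereal (a n * e' n)) \<le> ereal (f \<delta>) * limsup b \<and>
        liminf (\<lambda>n. ereal (a n * e' n)) \<le> ereal (f \<delta>) * liminf b"
    if \<delta>: "0 < \<delta>" "\<delta> < 1" for \<delta>
  proof -
    define l where "l = 1 - \<delta>"
    have l: "0 < l" "l < 1" using \<delta> by (auto simp: l_def)
    obtain K k where shift': "\<And>n p. 1 \<le> n \<Longrightarrow> e' (n + p * k) \<le> (1 + \<delta>) * e n + K / 2 ^ p"
      using shift[OF \<delta>(1)] by blast
    \<comment> \<open>The denominator is \<open>k + 1\<close> rather than \<open>k\<close> so that \<open>k = 0\<close> is covered as well.\<close>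
    define \<theta> where "\<theta> = (1 - l) / (real k + 1)"
    have "0 < \<theta>" using l by (simp add: \<theta>_def)
    define m where "m n = nat \<lfloor>l * real n\<rfloor>" for n
    define p where "p n = nat \<lfloor>\<theta> * real n\<rfloor>" for n
    define \<eta> where "\<eta> n = K * (a n / 2 ^ p n)" for n
    define c where "c n = (1 + \<delta>) * inverse (a (m n) / a n)" for n
    have \<eta>: "(\<lambda>n. ereal (\<eta> n)) \<longlonglongrightarrow> ereal (K * 0)"
      unfolding \<eta>_def p_def
      by (intro tendsto_ereal tendsto_intros regularly_varying_times_exponential_tendsto_0 pos rv \<open>0 < \<theta>\<close>)
    have "c \<longlonglongrightarrow> (1 + \<delta>) * inverse (l powr \<rho>)"
      unfolding c_def m_def using l by (intro tendsto_intros \<rho>) auto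
    then have c: "(\<lambda>n. ereal (c n)) \<longlonglongrightarrow> ereal (f \<delta>)"
      by (simp add: f_def l_def powr_minus)
    have "0 < f \<delta>" using \<delta> by (simp add: f_def)
    have "filterlim m at_top sequentially"
      unfolding m_def using l by real_asymp
    then have "\<forall>\<^sub>F n in sequentially. 1 \<le> m n"
      by (simp add: filterlim_at_top)
    then have le: "\<forall>\<^sub>F n in sequentially. ereal (a n * e' n) \<le> ereal (\<eta> n) + ereal (c n) * b (m n)"
    proof eventually_elim
      case (elim n)
      have "real (m n + p n * k) \<le> l * real n + \<theta> * real n * real k"
        using l(1) \<open>0 < \<theta>\<close> unfolding m_def p_def of_nat_add of_nat_mult
        by (intro add_mono mult_right_mono) (auto simp: of_nat_nat)
      also have "\<dots> \<le> l * real n + (1 - l) * real n"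
      proof -
        have "\<theta> * real k \<le> 1 - l"
          using l by (simp add: \<theta>_def field_simps)
        from mult_right_mono[OF this, of "real n"] show ?thesis by (simp add: mult_ac)
      qed
      finally have "m n + p n * k \<le> n" by (simp add: algebra_simps flip: of_nat_add of_nat_mult)
      then have "e' n \<le> e' (m n + p n * k)" by (rule anti)
      also have "\<dots> \<le> (1 + \<delta>) * e (m n) + K / 2 ^ p n" by (rule shift'[OF elim])
      finally have "a n * e' n \<le> a n * ((1 + \<delta>) * e (m n) + K / 2 ^ p n)"
        using pos[of n] by simp
      also have "\<dots> = \<eta> n + c n * (a (m n) * e (m n))"
        using pos[of n] pos[of "m n"] by (simp add: \<eta>_def c_def field_simps)
      finally show ?case by (simp add: b_def)
    qed
    have "limsup (\<lambda>n. ereal (a n * e' n)) \<le> limsup (\<lambda>n. ereal (\<eta> n) + ereal (c n) * b (m n))"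
      by (rule Limsup_mono[OF le])
    also have "\<dots> = ereal (f \<delta>) * limsup (\<lambda>n. b (m n))"
      using ereal_limsup_lim_add[OF \<eta>] ereal_limsup_lim_mult[OF c] \<open>0 < f \<delta>\<close> by simp
    also have "\<dots> \<le> ereal (f \<delta>) * limsup b"
      using Limsup_filtermap_ge[of sequentially b m] filtermap_floor_sequentially[OF l] \<open>0 < f \<delta>\<close>
      by (intro ereal_mult_left_mono) (auto simp: m_def[abs_def])
    finally have 1: "limsup (\<lambda>n. ereal (a n * e' n)) \<le> ereal (f \<delta>) * limsup b" .
    have "liminf (\<lambda>n. ereal (a n * e' n)) \<le> liminf (\<lambda>n. ereal (\<eta> n) + ereal (c n) * b (m n))"
      by (rule Liminf_mono[OF le])
    also have "\<dots> = ereal (f \<delta>) * liminf (\<lambda>n. b (m n))"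
      using ereal_liminf_lim_add[OF \<eta>] ereal_liminf_lim_mult[OF c] \<open>0 < f \<delta>\<close> by simp
    also have "\<dots> \<le> ereal (f \<delta>) * liminf b"
      using Liminf_comp_le_Liminf_filtermap[of sequentially b m] filtermap_floor_sequentially[OF l] \<open>0 < f \<delta>\<close>
      by (intro ereal_mult_left_mono) (auto simp: m_def[abs_def])
    finally show ?thesis using 1 by blast
  qed
  moreover have f: "(f \<longlongrightarrow> 1) (at_right 0)"
    unfolding f_def by real_asymp
  moreover have b: "0 \<le> b n" for n
    using pos[of n] nonneg[of n] by (simp add: b_def)
  moreover have "0 \<le> limsup b" "0 \<le> liminf b"
    using b by (auto intro!: le_Limsup Liminf_bounded always_eventually)
  ultimately show "limsup (\<lambda>n. ereal (a n * e' n)) \<le> limsup (\<lambda>n. ereal (a n * e n))"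
    and "liminf (\<lambda>n. ereal (a n * e' n)) \<le> liminf (\<lambda>n. ereal (a n * e n))"
    unfolding b_def[symmetric] by (auto intro: ereal_le_of_scaled_le)
qed

section \<open>Coordinates and diagonal maps in \<open>\<ell>\<^sub>2\<close>\<close>

lemma norm_ell2_le:
  assumes "\<And>i. \<bar>ell2_nth x i\<bar> \<le> c * \<bar>ell2_nth y i\<bar>" "0 \<le> c"
  shows "norm x \<le> c * norm y"
proof -
  have "(\<Sum>i. (ell2_nth x i)\<^sup>2) \<le> (\<Sum>i. c\<^sup>2 * (ell2_nth y i)\<^sup>2)"
  proof (intro suminf_le summable_mult summable_ell2_square)
    fix i
    have "\<bar>ell2_nth x i\<bar>\<^sup>2 \<le> (c * \<bar>ell2_nth y i\<bar>)\<^sup>2"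
      by (intro power_mono assms(1)) simp
    then show "(ell2_nth x i)\<^sup>2 \<le> c\<^sup>2 * (ell2_nth y i)\<^sup>2"
      by (simp add: power_mult_distrib)
  qed
  also have "\<dots> = c\<^sup>2 * (\<Sum>i. (ell2_nth y i)\<^sup>2)"
    by (intro suminf_mult summable_ell2_square)
  finally have "norm x \<le> sqrt (c\<^sup>2 * (\<Sum>i. (ell2_nth y i)\<^sup>2))"
    unfolding norm_ell2_def by simp
  then show ?thesis
    using \<open>0 \<le> c\<close> by (simp add: norm_ell2_def real_sqrt_mult)
qed

definition ell2_unit :: "nat \<Rightarrow> ell2" where
  "ell2_unit j = Abs_ell2 (\<lambda>i. if i = j then 1 else 0)"

lemma ell2_nth_unit: "ell2_nth (ell2_unit j) i = (if i = j then 1 else 0)"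
proof -
  have "summable (\<lambda>i. (if i = j then 1 else 0 :: real)\<^sup>2)"
    by (rule summable_finite[of "{j}"]) auto
  then show ?thesis by (simp add: ell2_unit_def Abs_ell2_inverse)
qed

lemma norm_ell2_unit: "norm (ell2_unit j) = 1"
proof -
  have "(\<Sum>i. (ell2_nth (ell2_unit j) i)\<^sup>2) = (\<Sum>i\<in>{j}. (ell2_nth (ell2_unit j) i)\<^sup>2)"
    by (rule suminf_finite) (auto simp: ell2_nth_unit)
  then show ?thesis by (simp add: norm_ell2_def ell2_nth_unit)
qed

lemma ell2_nth_sum_units: "ell2_nth (\<Sum>j<k. c j *\<^sub>R ell2_unit j) i = (if i < k then c i else 0)"
  by (induction k) (auto simp: ell2_nth_unit less_Suc_eq)

definition ell2_diagonal :: "(nat \<Rightarrow> real) \<Rightarrow> ell2 \<Rightarrow> ell2" where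
  "ell2_diagonal d y = Abs_ell2 (\<lambda>j. d j * ell2_nth y j)"

lemma ell2_nth_diagonal:
  assumes "\<And>j. \<bar>d j\<bar> \<le> L"
  shows "ell2_nth (ell2_diagonal d y) j = d j * ell2_nth y j"
proof -
  have "summable (\<lambda>j. (d j * ell2_nth y j)\<^sup>2)"
  proof (rule summable_comparison_test'[where N = 0])
    show "summable (\<lambda>j. L\<^sup>2 * (ell2_nth y j)\<^sup>2)"
      by (intro summable_mult summable_ell2_square)
    fix j
    have "\<bar>d j\<bar>\<^sup>2 \<le> L\<^sup>2" by (intro power_mono assms) simp
    then show "norm ((d j * ell2_nth y j)\<^sup>2) \<le> L\<^sup>2 * (ell2_nth y j)\<^sup>2"
      by (simp add: power_mult_distrib mult_right_mono)
  qed
  then show ?thesis by (simp add: ell2_diagonal_def Abs_ell2_inverse)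
qed

lemma ell2_diagonal_lipschitz:
  assumes "\<And>j. \<bar>d j\<bar> \<le> L"
  shows "norm (ell2_diagonal d x - ell2_diagonal d y) \<le> L * norm (x - y)"
proof (rule norm_ell2_le)
  show "0 \<le> L" using assms[of 0] by simp
  fix i
  have "ell2_nth (ell2_diagonal d x - ell2_diagonal d y) i = d i * ell2_nth (x - y) i"
    by (simp add: ell2_nth_diagonal[OF assms] algebra_simps)
  then show "\<bar>ell2_nth (ell2_diagonal d x - ell2_diagonal d y) i\<bar> \<le> L * \<bar>ell2_nth (x - y) i\<bar>"
    using assms[of i] by (simp add: abs_mult mult_right_mono)
qed

section \<open>Random operators whose driving sequences agree eventually\<close>

text \<open>The factor \<open>1/2\<close> is a constant below \<open>ln 2\<close>, the range that the exponential Markov inequality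
  with \<open>E exp (- \<zeta>) = 1/2\<close> can reach; any positive factor would serve the purpose.\<close>

definition linear_growth :: "(nat \<Rightarrow> real) \<Rightarrow> bool" where
  "linear_growth t \<longleftrightarrow> (\<forall>\<^sub>F j in sequentially. real (Suc j) / 2 \<le> (\<Sum>i\<le>j. t i))"

lemma linear_growth_filterlim:
  assumes "linear_growth t"
  shows "filterlim (\<lambda>j. \<Sum>i\<le>j. t i) at_top sequentially"
proof (rule filterlim_at_top_mono)
  show "filterlim (\<lambda>j. real (Suc j) / 2) at_top sequentially" by real_asymp
  show "\<forall>\<^sub>F j in sequentially. real (Suc j) / 2 \<le> (\<Sum>i\<le>j. t i)"
    using assms unfolding linear_growth_def .
qed

text \<open>This is where \<open>\<alpha> < 2\<close> enters: \<open>\<Gamma>\<^sub>j\<close> grows linearly and \<open>2 / \<alpha> > 1\<close>, so the coordinates of the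
  random operator are square summable and it really takes values in \<open>\<ell>\<^sub>2\<close>.\<close>

lemma linear_growth_square_summable:
  assumes "0 < \<alpha>" "\<alpha> < 2" and "linear_growth t"
  shows "summable (\<lambda>j. ((\<Sum>i\<le>j. t i) powr (- 1 / \<alpha>))\<^sup>2)"
proof (rule summable_comparison_test_ev)
  have "summable (\<lambda>j. real j powr (- 2 / \<alpha>))"
    using assms by (simp add: summable_real_powr_iff field_simps)
  then have "summable (\<lambda>j. real (Suc j) powr (- 2 / \<alpha>))"
    by (subst summable_Suc_iff)
  then show "summable (\<lambda>j. (1 / 2) powr (- 2 / \<alpha>) * real (Suc j) powr (- 2 / \<alpha>))"
    by (rule summable_mult)
  show "\<forall>\<^sub>F j in sequentially. norm (((\<Sum>i\<le>j. t i) powr (- 1 / \<alpha>))\<^sup>2)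
      \<le> (1 / 2) powr (- 2 / \<alpha>) * real (Suc j) powr (- 2 / \<alpha>)"
    using assms(3) unfolding linear_growth_def
  proof eventually_elim
    case (elim j)
    have "((\<Sum>i\<le>j. t i) powr (- 1 / \<alpha>))\<^sup>2 = (\<Sum>i\<le>j. t i) powr (- 2 / \<alpha>)"
      by (simp add: power2_eq_square powr_add[symmetric])
    also have "\<dots> \<le> (1 / 2 * real (Suc j)) powr (- 2 / \<alpha>)"
      using elim assms(1) by (intro powr_mono2') auto
    also have "\<dots> = (1 / 2) powr (- 2 / \<alpha>) * real (Suc j) powr (- 2 / \<alpha>)"
      by (rule powr_mult) 
    finally show ?case by simp
  qed
qed

lemma ell2_nth_random_operator:
  assumes "0 < \<alpha>" "\<alpha> < 2" "linear_growth t" and "\<And>j. \<bar>u z (x j)\<bar> \<le> 1"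
  shows "ell2_nth (random_operator \<alpha> S u x t z) j =
    c_const \<alpha> * measure S (space S) powr (1 / \<alpha>) * (u z (x j) * (\<Sum>i\<le>j. t i) powr (- 1 / \<alpha>))"
proof -
  have "summable (\<lambda>j. (u z (x j) * (\<Sum>i\<le>j. t i) powr (- 1 / \<alpha>))\<^sup>2)"
  proof (rule summable_comparison_test'[where N = 0])
    show "summable (\<lambda>j. ((\<Sum>i\<le>j. t i) powr (- 1 / \<alpha>))\<^sup>2)"
      by (rule linear_growth_square_summable) fact+
    fix j
    have "(u z (x j))\<^sup>2 \<le> 1" using assms(4)[of j] by (simp add: abs_square_le_1)
    then show "norm ((u z (x j) * (\<Sum>i\<le>j. t i) powr (- 1 / \<alpha>))\<^sup>2) \<le> ((\<Sum>i\<le>j. t i) powr (- 1 / \<alpha>))\<^sup>2"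
      by (simp add: power_mult_distrib mult_left_le_one_le)
  qed
  from summable_square_scale[OF this] show ?thesis
    by (simp add: random_operator_def Abs_ell2_inverse)
qed

lemma random_operator_bounded:
  assumes "0 < \<alpha>" "\<alpha> < 2" "linear_growth t" and "\<And>z j. norm z \<le> 1 \<Longrightarrow> \<bar>u z (x j)\<bar> \<le> 1"
  shows "\<exists>R. \<forall>z. norm z \<le> 1 \<longrightarrow> norm (random_operator \<alpha> S u x t z) \<le> R"
proof -
  let ?w = "\<lambda>j. c_const \<alpha> * measure S (space S) powr (1 / \<alpha>) * (\<Sum>i\<le>j. t i) powr (- 1 / \<alpha>)"
  have "summable (\<lambda>j. (?w j)\<^sup>2)"
    by (intro summable_square_scale linear_growth_square_summable) fact+
  then have w: "ell2_nth (Abs_ell2 ?w) j = ?w j" for j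
    by (simp add: Abs_ell2_inverse)
  have "norm (random_operator \<alpha> S u x t z) \<le> 1 * norm (Abs_ell2 ?w)" if "norm z \<le> 1" for z
  proof (rule norm_ell2_le)
    fix j
    have "\<bar>u z (x j)\<bar> * \<bar>?w j\<bar> \<le> 1 * \<bar>?w j\<bar>"
      by (intro mult_right_mono assms(4) that) simp
    then show "\<bar>ell2_nth (random_operator \<alpha> S u x t z) j\<bar> \<le> 1 * \<bar>ell2_nth (Abs_ell2 ?w) j\<bar>"
      unfolding w ell2_nth_random_operator[where u = u and z = z and x = x, OF assms(1-3) assms(4)[OF that]]
      by (simp add: abs_mult mult_ac)
  qed simp
  then show ?thesis by auto
qed

text \<open>If the driving sequences agree from some index on, the partial sums \<open>\<Gamma>\<^sub>j\<close> and \<open>\<Gamma>'\<^sub>j\<close> eventually differ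
  by a constant, hence \<open>\<Gamma>'\<^sub>j / \<Gamma>\<^sub>j \<rightarrow> 1\<close>.  Beyond a large index \<open>k\<close> the new operator is therefore the old
  one followed by a diagonal map with entries at most \<open>1 + \<epsilon>\<close>, and the first \<open>k\<close> coordinates form a
  bounded finite-rank part.\<close>

lemma entropy_number_random_operator_tail_perturbation:
  fixes u :: "'e::real_normed_vector \<Rightarrow> 's \<Rightarrow> real"
  assumes \<alpha>: "0 < \<alpha>" "\<alpha> < 2" and growth: "linear_growth t" "linear_growth t'"
    and u: "\<And>z j. norm z \<le> 1 \<Longrightarrow> \<bar>u z (x j)\<bar> \<le> 1" "\<And>z j. norm z \<le> 1 \<Longrightarrow> \<bar>u z (x' j)\<bar> \<le> 1"
    and agree: "\<And>j. m \<le> j \<Longrightarrow> x j = x' j \<and> t j = t' j" and "0 < \<epsilon>"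
  shows "\<exists>K k. \<forall>n\<ge>1. \<forall>p. entropy_number (n + p * k) (random_operator \<alpha> S u x' t')
    \<le> (1 + \<epsilon>) * entropy_number n (random_operator \<alpha> S u x t) + K / 2 ^ p"
proof -
  define \<Gamma> where "\<Gamma> j = (\<Sum>i\<le>j. t i)" for j
  define \<Gamma>' where "\<Gamma>' j = (\<Sum>i\<le>j. t' i)" for j
  define \<kappa> where "\<kappa> = c_const \<alpha> * measure S (space S) powr (1 / \<alpha>)"
  define D where "D = (\<Sum>i<m. t' i - t i)"
  let ?v = "random_operator \<alpha> S u x t" and ?v' = "random_operator \<alpha> S u x' t'"
  have v: "ell2_nth (?v z) j = \<kappa> * (u z (x j) * \<Gamma> j powr (- 1 / \<alpha>))" if "norm z \<le> 1" for z j
    unfolding \<kappa>_def \<Gamma>_def by (rule ell2_nth_random_operator[where u = u and z = z and x = x, OF \<alpha> growth(1) u(1)[OF that]])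
  have v': "ell2_nth (?v' z) j = \<kappa> * (u z (x' j) * \<Gamma>' j powr (- 1 / \<alpha>))" if "norm z \<le> 1" for z j
    unfolding \<kappa>_def \<Gamma>'_def by (rule ell2_nth_random_operator[where u = u and z = z and x = x', OF \<alpha> growth(2) u(2)[OF that]])
  have shift: "\<Gamma>' j = \<Gamma> j + D" if "m \<le> j" for j
  proof -
    have "\<Gamma>' j - \<Gamma> j = (\<Sum>i\<le>j. t' i - t i)"
      by (simp add: \<Gamma>_def \<Gamma>'_def sum_subtractf)
    also have "\<dots> = D"
      unfolding D_def using agree that by (intro sum.mono_neutral_right) auto
    finally show ?thesis by simp
  qed
  have \<Gamma>_top: "filterlim \<Gamma> at_top sequentially" and \<Gamma>'_top: "filterlim \<Gamma>' at_top sequentially"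
    using growth by (auto simp: \<Gamma>_def[abs_def] \<Gamma>'_def[abs_def] intro: linear_growth_filterlim)
  define d where "d j = ((\<Gamma> j + D) / \<Gamma> j) powr (- 1 / \<alpha>)" for j
  have "((\<lambda>y. ((y + D) / y) powr (- 1 / \<alpha>)) \<longlongrightarrow> 1) at_top"
  proof -
    have "((\<lambda>y. (y + D) / y) \<longlongrightarrow> 1) at_top" by real_asymp
    then have "((\<lambda>y. ((y + D) / y) powr (- 1 / \<alpha>)) \<longlongrightarrow> 1 powr (- 1 / \<alpha>)) at_top"
      by (intro tendsto_powr tendsto_const) auto
    then show ?thesis by simp
  qed
  from filterlim_compose[OF this \<Gamma>_top] have "d \<longlonglongrightarrow> 1"
    by (simp add: d_def[abs_def])
  then have "\<forall>\<^sub>F j in sequentially. d j < 1 + \<epsilon>"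
    using \<open>0 < \<epsilon>\<close> by (intro order_tendstoD) auto
  moreover have "\<forall>\<^sub>F j in sequentially. 0 < \<Gamma> j" "\<forall>\<^sub>F j in sequentially. 0 < \<Gamma>' j"
    using \<Gamma>_top \<Gamma>'_top by (auto simp: filterlim_at_top_dense)
  ultimately have "\<forall>\<^sub>F j in sequentially. d j < 1 + \<epsilon> \<and> 0 < \<Gamma> j \<and> 0 < \<Gamma>' j \<and> m \<le> j"
    using eventually_ge_at_top[of m] by eventually_elim simp
  then obtain k where k: "\<And>j. k \<le> j \<Longrightarrow> d j < 1 + \<epsilon> \<and> 0 < \<Gamma> j \<and> 0 < \<Gamma>' j \<and> m \<le> j"
    unfolding eventually_sequentially by blast
  define d' where "d' j = (if j < k then 0 else d j)" for j
  have d': "\<bar>d' j\<bar> \<le> 1 + \<epsilon>" for j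
    using k[of j] \<open>0 < \<epsilon>\<close> by (auto simp: d'_def d_def)
  define c where "c z j = ell2_nth (?v' z) j" for z j
  define K where "K = (\<Sum>j<k. \<bar>\<kappa> * \<Gamma>' j powr (- 1 / \<alpha>)\<bar>)"
  obtain R where R: "\<And>z. norm z \<le> 1 \<Longrightarrow> norm (?v z) \<le> R"
    using random_operator_bounded[where u = u and x = x, OF \<alpha> growth(1) u(1)] by blast
  obtain R' where R': "\<And>z. norm z \<le> 1 \<Longrightarrow> norm (?v' z) \<le> R'"
    using random_operator_bounded[where u = u and x = x', OF \<alpha> growth(2) u(2)] by blast
  have decomp: "?v' z = (\<Sum>j<k. c z j *\<^sub>R ell2_unit j) + ell2_diagonal d' (?v z)" if "norm z \<le> 1" for z
  proof (rule ell2_eqI)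
    fix i
    show "ell2_nth (?v' z) i = ell2_nth ((\<Sum>j<k. c z j *\<^sub>R ell2_unit j) + ell2_diagonal d' (?v z)) i"
    proof (cases "i < k")
      case True
      then show ?thesis
        by (simp add: ell2_nth_sum_units ell2_nth_diagonal[OF d'] d'_def c_def)
    next
      case False
      then have i: "0 < \<Gamma> i" "0 < \<Gamma>' i" "m \<le> i" using k[of i] by auto
      have "\<Gamma>' i powr (- 1 / \<alpha>) = d i * \<Gamma> i powr (- 1 / \<alpha>)"
        using i unfolding d_def shift[OF i(3), symmetric] by (simp add: powr_mult[symmetric])
      then show ?thesis
        using False agree[OF i(3)]
        by (simp add: ell2_nth_sum_units ell2_nth_diagonal[OF d'] d'_def v[OF that] v'[OF that])
    qed
  qed
  have c: "\<bar>c z j\<bar> \<le> K" if "norm z \<le> 1" "j < k" for z j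
  proof -
    have "\<bar>u z (x' j)\<bar> * \<bar>\<kappa> * \<Gamma>' j powr (- 1 / \<alpha>)\<bar> \<le> 1 * \<bar>\<kappa> * \<Gamma>' j powr (- 1 / \<alpha>)\<bar>"
      by (intro mult_right_mono u(2) that) simp
    also have "\<dots> \<le> K"
      unfolding K_def using that(2) by (simp only: mult_1) (rule member_le_sum, auto)
    finally show ?thesis by (simp add: c_def v'[OF that(1)] abs_mult mult_ac)
  qed
  have "0 \<le> K" unfolding K_def by (intro sum_nonneg) simp
  have "entropy_number (n + p * k) ?v' \<le> (1 + \<epsilon>) * entropy_number n ?v + real k * K / 2 ^ p"
    if "1 \<le> n" for n p
    by (rule entropy_number_finite_rank_perturbation[where c = c and e = ell2_unit and T = "ell2_diagonal d'"])
       (use decomp c norm_ell2_unit \<open>0 \<le> K\<close> ell2_diagonal_lipschitz[OF d'] \<open>0 < \<epsilon>\<close> R R' that in auto)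
  then show ?thesis by blast
qed

lemma limsup_liminf_entropy_numbers_tail_le:
  fixes S :: "'s measure" and a :: "nat \<Rightarrow> real" and u :: "'e::real_normed_vector \<Rightarrow> 's \<Rightarrow> real"
  assumes \<alpha>: "0 < \<alpha>" "\<alpha> < 2" and growth: "linear_growth t" "linear_growth t'"
    and u: "\<And>z j. norm z \<le> 1 \<Longrightarrow> \<bar>u z (x j)\<bar> \<le> 1" "\<And>z j. norm z \<le> 1 \<Longrightarrow> \<bar>u z (x' j)\<bar> \<le> 1"
    and agree: "\<And>j. m \<le> j \<Longrightarrow> x j = x' j \<and> t j = t' j"
    and a: "\<And>n. 0 < a n" "regularly_varying a"
  defines "e \<equiv> \<lambda>x t n. ereal (a n * entropy_number n (random_operator \<alpha> S u x t))"
  shows "limsup (e x' t') \<le> limsup (e x t)" and "liminf (e x' t') \<le> liminf (e x t)"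
proof -
  obtain R where R: "\<And>z. norm z \<le> 1 \<Longrightarrow> norm (random_operator \<alpha> S u x t z) \<le> R"
    using random_operator_bounded[where u = u and x = x, OF \<alpha> growth(1) u(1)] by blast
  obtain R' where R': "\<And>z. norm z \<le> 1 \<Longrightarrow> norm (random_operator \<alpha> S u x' t' z) \<le> R'"
    using random_operator_bounded[where u = u and x = x', OF \<alpha> growth(2) u(2)] by blast
  note le = limsup_liminf_le_of_shifted_le[OF a entropy_number_nonneg[of "random_operator \<alpha> S u x t", OF R]
    entropy_number_antimono[of "random_operator \<alpha> S u x' t'", OF R']
    entropy_number_random_operator_tail_perturbation[OF \<alpha> growth u agree]]
  show "limsup (e x' t') \<le> limsup (e x t)" "liminf (e x' t') \<le> liminf (e x t)"
    unfolding e_def by (rule le; assumption)+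
qed

section \<open>A zero-one law for completed products\<close>

text \<open>The map \<open>T\<close> replaces part of a random point by an independent copy without changing the law.  If it
  keeps the part of \<open>\<omega>\<close> that decides \<open>D\<close>, and whether the new point lies in \<open>B\<close> depends on the copy
  \<open>\<omega>'\<close> alone, then \<open>B\<close> is independent of \<open>D\<close>.  Being independent of a generator, \<open>B\<close> is independent of
  itself.  The dependence on \<open>\<omega>'\<close> alone is only asked for up to null sets, which is what makes the
  argument applicable to events of the completed measure.\<close>

lemma (in prob_space) zero_one_law_by_resampling:
  assumes E: "Int_stable E" "E \<subseteq> Pow (space M)" "space M \<in> E" "sets M = sigma_sets (space M) E"
    and B [measurable]: "B \<in> sets M"
    and resample: "\<And>D. D \<in> E \<Longrightarrow> \<exists>T h. T \<in> M \<Otimes>\<^sub>M M \<rightarrow>\<^sub>M M \<and> distr (M \<Otimes>\<^sub>M M) M T = M \<and>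
      (\<forall>\<omega>\<in>space M. \<forall>\<omega>'\<in>space M. T (\<omega>, \<omega>') \<in> D \<longleftrightarrow> \<omega> \<in> D) \<and>
      (AE \<omega> in M. AE \<omega>' in M. T (\<omega>, \<omega>') \<in> B \<longleftrightarrow> h \<omega>')"
  shows "emeasure M B = 0 \<or> emeasure M B = 1"
proof -
  have indep: "emeasure M (B \<inter> D) = emeasure M B * emeasure M D" if D: "D \<in> E" for D
  proof -
    have [measurable]: "D \<in> sets M" using D E(4) by (simp add: sigma_sets.Basic)
    obtain T h where T [measurable]: "T \<in> M \<Otimes>\<^sub>M M \<rightarrow>\<^sub>M M" and distr: "distr (M \<Otimes>\<^sub>M M) M T = M"
      and TD: "\<And>\<omega> \<omega>'. \<omega> \<in> space M \<Longrightarrow> \<omega>' \<in> space M \<Longrightarrow> T (\<omega>, \<omega>') \<in> D \<longleftrightarrow> \<omega> \<in> D"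
      and h: "AE \<omega> in M. AE \<omega>' in M. T (\<omega>, \<omega>') \<in> B \<longleftrightarrow> h \<omega>'"
      using resample[OF D] by blast
    define g where "g \<omega> = (\<integral>\<^sup>+ \<omega>'. indicator B (T (\<omega>, \<omega>')) \<partial>M)" for \<omega>
    \<comment> \<open>A single typical \<open>\<omega>0\<close> stands in for \<open>h\<close>, about whose measurability nothing is known.\<close>
    have "\<exists>\<omega>0\<in>space M. AE \<omega>' in M. T (\<omega>0, \<omega>') \<in> B \<longleftrightarrow> h \<omega>'"
    proof (rule ccontr)
      assume "\<not> ?thesis"
      then have "AE \<omega> in M. False" using h by (auto elim!: AE_mp)
      then show False by simp
    qed
    then obtain \<omega>0 where \<omega>0: "\<omega>0 \<in> space M" "AE \<omega>' in M. T (\<omega>0, \<omega>') \<in> B \<longleftrightarrow> h \<omega>'" by blast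
    have g: "AE \<omega> in M. g \<omega> = g \<omega>0"
      using h
    proof eventually_elim
      case (elim \<omega>)
      show ?case unfolding g_def
        using elim \<omega>0(2) by (intro nn_integral_cong_AE) (auto simp: indicator_def)
    qed
    have split: "emeasure M (B \<inter> D') = g \<omega>0 * emeasure M D'"
      if [measurable]: "D' \<in> sets M"
        and TD': "\<And>\<omega> \<omega>'. \<omega> \<in> space M \<Longrightarrow> \<omega>' \<in> space M \<Longrightarrow> T (\<omega>, \<omega>') \<in> D' \<longleftrightarrow> \<omega> \<in> D'" for D'
    proof -
      have "emeasure M (B \<inter> D') = (\<integral>\<^sup>+ \<omega>. indicator (B \<inter> D') \<omega> \<partial>distr (M \<Otimes>\<^sub>M M) M T)"
        by (simp add: distr)
      also have "\<dots> = (\<integral>\<^sup>+ p. indicator (B \<inter> D') (T p) \<partial>(M \<Otimes>\<^sub>M M))"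
        by (rule nn_integral_distr) measurable
      also have "\<dots> = (\<integral>\<^sup>+ \<omega>. \<integral>\<^sup>+ \<omega>'. indicator (B \<inter> D') (T (\<omega>, \<omega>')) \<partial>M \<partial>M)"
        by (rule nn_integral_fst[where f = "\<lambda>p. indicator (B \<inter> D') (T p)", symmetric]) measurable
      also have "\<dots> = (\<integral>\<^sup>+ \<omega>. g \<omega> * indicator D' \<omega> \<partial>M)"
      proof (rule nn_integral_cong)
        fix \<omega> assume "\<omega> \<in> space M"
        then have "(\<integral>\<^sup>+ \<omega>'. indicator (B \<inter> D') (T (\<omega>, \<omega>')) \<partial>M)
            = (\<integral>\<^sup>+ \<omega>'. indicator B (T (\<omega>, \<omega>')) * indicator D' \<omega> \<partial>M)"
          using TD' by (intro nn_integral_cong) (auto simp: indicator_def)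
        also have "\<dots> = g \<omega> * indicator D' \<omega>"
          unfolding g_def using \<open>\<omega> \<in> space M\<close> by (intro nn_integral_multc) measurable
        finally show "(\<integral>\<^sup>+ \<omega>'. indicator (B \<inter> D') (T (\<omega>, \<omega>')) \<partial>M) = g \<omega> * indicator D' \<omega>" .
      qed
      also have "\<dots> = (\<integral>\<^sup>+ \<omega>. g \<omega>0 * indicator D' \<omega> \<partial>M)"
        using g by (intro nn_integral_cong_AE) auto
      finally show ?thesis by (simp add: nn_integral_cmult_indicator)
    qed
    have "emeasure M (B \<inter> space M) = g \<omega>0 * emeasure M (space M)"
      using measurable_space[OF T] by (intro split) (auto simp: space_pair_measure)
    then have "emeasure M B = g \<omega>0" by (simp add: emeasure_space_1)
    then show ?thesis using split[OF _ TD] by simp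
  qed
  have "density M (indicator B) = scale_measure (emeasure M B) M"
  proof (rule measure_eqI_generator_eq[where E = E and \<Omega> = "space M" and A = "\<lambda>_. space M"])
    fix D assume D: "D \<in> E"
    then have [measurable]: "D \<in> sets M" using E(4) by (simp add: sigma_sets.Basic)
    show "emeasure (density M (indicator B)) D = emeasure (scale_measure (emeasure M B) M) D"
      using indep[OF D] by (simp add: emeasure_density indicator_inter_arith[symmetric])
  next
    show "emeasure (density M (indicator B)) (space M) \<noteq> \<infinity>" for i :: nat
      by (simp add: emeasure_density)
  qed (use E in auto)
  then have "emeasure (density M (indicator B)) B = emeasure (scale_measure (emeasure M B) M) B"
    by simp
  then have "emeasure M B = emeasure M B * emeasure M B"
    by (simp add: emeasure_density indicator_inter_arith[symmetric])
  then show ?thesis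
    by (metis emeasure_finite ennreal_mult_cancel_left infinity_ennreal_def mult.right_neutral)
qed


text \<open>Splicing an independent copy onto an initial segment preserves the law of each of the two
  sequences, and Fubini's theorem combines the two statements on rectangles.\<close>

lemma distr_resample_initial_segment:
  fixes M :: "'a measure" and N :: "'b measure"
  assumes "prob_space M" "prob_space N"
  defines "X \<equiv> \<Pi>\<^sub>M i\<in>(UNIV :: nat set). M" and "Y \<equiv> \<Pi>\<^sub>M i\<in>(UNIV :: nat set). N"
  shows "distr ((X \<Otimes>\<^sub>M Y) \<Otimes>\<^sub>M (X \<Otimes>\<^sub>M Y)) (X \<Otimes>\<^sub>M Y)
      (\<lambda>(p, q). (comb_seq m (fst p) (fst q), comb_seq m (snd p) (snd q))) = X \<Otimes>\<^sub>M Y"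
    (is "distr _ _ ?T = _")
proof -
  interpret M: prob_space M by fact
  interpret N: prob_space N by fact
  interpret XS: sequence_space M ..
  interpret YS: sequence_space N ..
  interpret X: prob_space X unfolding X_def by (rule prob_space_PiM) (rule assms)
  interpret Y: prob_space Y unfolding Y_def by (rule prob_space_PiM) (rule assms)
  interpret XY: pair_prob_space X Y ..
  have [measurable]: "(\<lambda>z. comb_seq m (f z) (g z)) \<in> K \<rightarrow>\<^sub>M X"
    if "f \<in> K \<rightarrow>\<^sub>M X" "g \<in> K \<rightarrow>\<^sub>M X" for f g and K :: "'k measure"
    using that unfolding X_def by (rule measurable_comb_seq')
  have [measurable]: "(\<lambda>z. comb_seq m (f z) (g z)) \<in> K \<rightarrow>\<^sub>M Y"
    if "f \<in> K \<rightarrow>\<^sub>M Y" "g \<in> K \<rightarrow>\<^sub>M Y" for f g and K :: "'k measure"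
    using that unfolding Y_def by (rule measurable_comb_seq')
  have T [measurable]: "?T \<in> (X \<Otimes>\<^sub>M Y) \<Otimes>\<^sub>M (X \<Otimes>\<^sub>M Y) \<rightarrow>\<^sub>M X \<Otimes>\<^sub>M Y"
    unfolding split_beta' by measurable
  have marginal_X: "(\<integral>\<^sup>+ x. \<integral>\<^sup>+ x'. indicator A (comb_seq m x x') \<partial>X \<partial>X) = emeasure X A"
    if [measurable]: "A \<in> sets X" for A
  proof -
    have "emeasure X A = (\<integral>\<^sup>+ x. indicator A x \<partial>distr (X \<Otimes>\<^sub>M X) X (\<lambda>(x, x'). comb_seq m x x'))"
      using XS.PiM_comb_seq[of m] by (simp add: X_def[symmetric])
    also have "\<dots> = (\<integral>\<^sup>+ p. indicator A (comb_seq m (fst p) (snd p)) \<partial>(X \<Otimes>\<^sub>M X))"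
      by (subst nn_integral_distr) (auto simp: split_beta')
    also have "\<dots> = (\<integral>\<^sup>+ x. \<integral>\<^sup>+ x'. indicator A (comb_seq m x x') \<partial>X \<partial>X)"
      by (subst X.nn_integral_fst[symmetric]) auto
    finally show ?thesis by simp
  qed
  have marginal_Y: "(\<integral>\<^sup>+ y. \<integral>\<^sup>+ y'. indicator B (comb_seq m y y') \<partial>Y \<partial>Y) = emeasure Y B"
    if [measurable]: "B \<in> sets Y" for B
  proof -
    have "emeasure Y B = (\<integral>\<^sup>+ x. indicator B x \<partial>distr (Y \<Otimes>\<^sub>M Y) Y (\<lambda>(x, x'). comb_seq m x x'))"
      using YS.PiM_comb_seq[of m] by (simp add: Y_def[symmetric])
    also have "\<dots> = (\<integral>\<^sup>+ p. indicator B (comb_seq m (fst p) (snd p)) \<partial>(Y \<Otimes>\<^sub>M Y))"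
      by (subst nn_integral_distr) (auto simp: split_beta')
    also have "\<dots> = (\<integral>\<^sup>+ x. \<integral>\<^sup>+ x'. indicator B (comb_seq m x x') \<partial>Y \<partial>Y)"
      by (subst Y.nn_integral_fst[symmetric]) auto
    finally show ?thesis by simp
  qed
  show ?thesis
  proof (rule pair_measure_eqI[symmetric])
    fix A B assume [measurable]: "A \<in> sets X" "B \<in> sets Y"
    define \<alpha> where "\<alpha> x = (\<integral>\<^sup>+ x'. indicator A (comb_seq m x x') \<partial>X)" for x
    define \<beta> where "\<beta> y = (\<integral>\<^sup>+ y'. indicator B (comb_seq m y y') \<partial>Y)" for y
    have [measurable]: "\<alpha> \<in> borel_measurable X" "\<beta> \<in> borel_measurable Y"
      unfolding \<alpha>_def \<beta>_def by measurable
    let ?f = "\<lambda>p q. indicator A (comb_seq m (fst p) (fst q)) * indicator B (comb_seq m (snd p) (snd q)) :: ennreal"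
    have inner: "(\<integral>\<^sup>+ q. ?f p q \<partial>(X \<Otimes>\<^sub>M Y)) = \<alpha> (fst p) * \<beta> (snd p)" if "p \<in> space (X \<Otimes>\<^sub>M Y)" for p
    proof -
      have [measurable]: "fst p \<in> space X" "snd p \<in> space Y"
        using that by (auto simp: space_pair_measure)
      have "(\<integral>\<^sup>+ q. ?f p q \<partial>(X \<Otimes>\<^sub>M Y)) = (\<integral>\<^sup>+ x'. \<integral>\<^sup>+ y'. ?f p (x', y') \<partial>Y \<partial>X)"
        by (rule Y.nn_integral_fst[symmetric]) measurable
      also have "\<dots> = (\<integral>\<^sup>+ x'. indicator A (comb_seq m (fst p) x') * \<beta> (snd p) \<partial>X)"
        unfolding \<beta>_def fst_conv snd_conv by (intro nn_integral_cong nn_integral_cmult) measurable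
      also have "\<dots> = \<alpha> (fst p) * \<beta> (snd p)"
        unfolding \<alpha>_def by (rule nn_integral_multc) measurable
      finally show ?thesis .
    qed
    have "emeasure (distr ((X \<Otimes>\<^sub>M Y) \<Otimes>\<^sub>M (X \<Otimes>\<^sub>M Y)) (X \<Otimes>\<^sub>M Y) ?T) (A \<times> B)
        = (\<integral>\<^sup>+ z. indicator (A \<times> B) z \<partial>distr ((X \<Otimes>\<^sub>M Y) \<Otimes>\<^sub>M (X \<Otimes>\<^sub>M Y)) (X \<Otimes>\<^sub>M Y) ?T)"
      by simp
    also have "\<dots> = (\<integral>\<^sup>+ z. ?f (fst z) (snd z) \<partial>((X \<Otimes>\<^sub>M Y) \<Otimes>\<^sub>M (X \<Otimes>\<^sub>M Y)))"
      by (subst nn_integral_distr) (auto simp: split_beta' indicator_times)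
    also have "\<dots> = (\<integral>\<^sup>+ p. \<integral>\<^sup>+ q. ?f p q \<partial>(X \<Otimes>\<^sub>M Y) \<partial>(X \<Otimes>\<^sub>M Y))"
      by (subst XY.nn_integral_fst[symmetric]) auto
    also have "\<dots> = (\<integral>\<^sup>+ p. \<alpha> (fst p) * \<beta> (snd p) \<partial>(X \<Otimes>\<^sub>M Y))"
      by (rule nn_integral_cong) (rule inner)
    also have "\<dots> = (\<integral>\<^sup>+ x. \<integral>\<^sup>+ y. \<alpha> x * \<beta> y \<partial>Y \<partial>X)"
      by (subst Y.nn_integral_fst[symmetric]) auto
    also have "\<dots> = (\<integral>\<^sup>+ x. \<alpha> x * emeasure Y B \<partial>X)"
      unfolding \<beta>_def by (intro nn_integral_cong) (simp add: nn_integral_cmult marginal_Y)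
    also have "\<dots> = emeasure X A * emeasure Y B"
      using marginal_X[of A] unfolding \<alpha>_def[symmetric] by (simp add: nn_integral_multc)
    finally show "emeasure X A * emeasure Y B
        = emeasure (distr ((X \<Otimes>\<^sub>M Y) \<Otimes>\<^sub>M (X \<Otimes>\<^sub>M Y)) (X \<Otimes>\<^sub>M Y) ?T) (A \<times> B)"
      by simp
  qed (use X.sigma_finite_measure_axioms Y.sigma_finite_measure_axioms in auto)
qed

lemma prod_algebra_initial_segment:
  assumes "A \<in> prod_algebra (UNIV :: nat set) (\<lambda>_. M)"
  obtains m where "\<And>n x x'. m \<le> n \<Longrightarrow> x \<in> space (PiM UNIV (\<lambda>_. M)) \<Longrightarrow> x' \<in> space (PiM UNIV (\<lambda>_. M)) \<Longrightarrow>
    comb_seq n x x' \<in> A \<longleftrightarrow> x \<in> A"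
proof -
  obtain J F where A: "A = prod_emb UNIV (\<lambda>_. M) J (\<Pi>\<^sub>E j\<in>J. F j)" and "finite J"
    and F: "\<And>j. j \<in> J \<Longrightarrow> F j \<in> sets M"
    using prod_algebraE[OF assms] by metis
  obtain m where m: "\<And>j. j \<in> J \<Longrightarrow> j < m"
    using \<open>finite J\<close> by (metis finite_nat_iff_bounded subset_eq lessThan_iff)
  show thesis
  proof (rule that)
    fix n and x x' :: "nat \<Rightarrow> 'a"
    assume "m \<le> n" and x: "x \<in> space (PiM UNIV (\<lambda>_. M))" and x': "x' \<in> space (PiM UNIV (\<lambda>_. M))"
    have "comb_seq n x x' j = x j" if "j \<in> J" for j
      using m[OF that] \<open>m \<le> n\<close> by (simp add: comb_seq_less)
    moreover have "comb_seq n x x' j \<in> space M" for j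
      using x x' by (auto simp: space_PiM comb_seq_def)
    ultimately show "comb_seq n x x' \<in> A \<longleftrightarrow> x \<in> A"
      using x unfolding A by (auto simp: prod_emb_def space_PiM PiE_iff)
  qed
qed

lemma sets_pair_PiM_eq_sigma_cylinders:
  fixes M :: "'a measure" and N :: "'b measure"
  defines "X \<equiv> \<Pi>\<^sub>M i\<in>(UNIV :: nat set). M" and "Y \<equiv> \<Pi>\<^sub>M i\<in>(UNIV :: nat set). N"
  defines "E \<equiv> {a \<times> b |a b. a \<in> prod_algebra (UNIV :: nat set) (\<lambda>_. M) \<and> b \<in> prod_algebra (UNIV :: nat set) (\<lambda>_. N)}"
  shows "Int_stable E" "E \<subseteq> Pow (space (X \<Otimes>\<^sub>M Y))" "space (X \<Otimes>\<^sub>M Y) \<in> E"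
    "sets (X \<Otimes>\<^sub>M Y) = sigma_sets (space (X \<Otimes>\<^sub>M Y)) E"
proof -
  let ?A = "prod_algebra (UNIV :: nat set) (\<lambda>_. M)" and ?B = "prod_algebra (UNIV :: nat set) (\<lambda>_. N)"
  show "Int_stable E"
  proof (rule Int_stableI)
    fix U V assume "U \<in> E" "V \<in> E"
    then obtain a b c d where *: "U = a \<times> b" "V = c \<times> d" "a \<in> ?A" "c \<in> ?A" "b \<in> ?B" "d \<in> ?B"
      unfolding E_def by blast
    have "U \<inter> V = (a \<inter> c) \<times> (b \<inter> d)" unfolding * by blast
    moreover have "a \<inter> c \<in> ?A" "b \<inter> d \<in> ?B"
      using * Int_stable_prod_algebra unfolding Int_stable_def by blast+
    ultimately show "U \<inter> V \<in> E" unfolding E_def by blast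
  qed
  have X: "space X \<in> ?A" "?A \<subseteq> Pow (space X)"
    using space_in_prod_algebra[of UNIV "\<lambda>_. M"] prod_algebra_sets_into_space[of UNIV "\<lambda>_. M"]
    by (simp_all add: X_def space_PiM)
  have Y: "space Y \<in> ?B" "?B \<subseteq> Pow (space Y)"
    using space_in_prod_algebra[of UNIV "\<lambda>_. N"] prod_algebra_sets_into_space[of UNIV "\<lambda>_. N"]
    by (simp_all add: Y_def space_PiM)
  show E: "E \<subseteq> Pow (space (X \<Otimes>\<^sub>M Y))" "space (X \<Otimes>\<^sub>M Y) \<in> E"
    using X Y unfolding E_def space_pair_measure by blast+
  have "sets (X \<Otimes>\<^sub>M Y) = sets (sigma (space X) ?A \<Otimes>\<^sub>M sigma (space Y) ?B)"
    using X Y by (intro sets_pair_measure_cong) (simp_all add: X_def Y_def sets_PiM space_PiM)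
  also have "sigma (space X) ?A \<Otimes>\<^sub>M sigma (space Y) ?B = sigma (space X \<times> space Y) E"
    unfolding E_def using X Y by (intro sigma_prod) (auto intro!: exI[of _ "{space X}"] exI[of _ "{space Y}"])
  also have "sets \<dots> = sigma_sets (space (X \<Otimes>\<^sub>M Y)) E"
    using E by (simp add: space_pair_measure)
  finally show "sets (X \<Otimes>\<^sub>M Y) = sigma_sets (space (X \<Otimes>\<^sub>M Y)) E" .
qed

text \<open>Kolmogorov's zero-one law for the completed law of a pair of sequences.  An event of the completion
  agrees with a measurable event \<open>B\<close> almost surely, but \<open>B\<close> need not be a tail event any more, so the usual
  form of the law does not apply.  Replacing all coordinates beyond \<open>m\<close> by an independent copy keeps
  the cylinders on the first \<open>m\<close> coordinates, while membership in \<open>A\<close> depends on the copy only.  The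
  predicate \<open>G\<close> allows the insensitivity to fail on a null set of points.\<close>

lemma zero_one_law_finitely_insensitive_event:
  fixes M :: "'a measure" and N :: "'b measure"
  defines "X \<equiv> \<Pi>\<^sub>M i\<in>(UNIV :: nat set). M" and "Y \<equiv> \<Pi>\<^sub>M i\<in>(UNIV :: nat set). N"
  assumes "prob_space M" "prob_space N"
    and A: "A \<in> sets (completion (X \<Otimes>\<^sub>M Y))"
    and G: "AE p in X \<Otimes>\<^sub>M Y. G p"
    and insensitive: "\<And>p q m. G p \<Longrightarrow> G q \<Longrightarrow> (\<And>j. m \<le> j \<Longrightarrow> fst p j = fst q j \<and> snd p j = snd q j) \<Longrightarrow>
      p \<in> A \<longleftrightarrow> q \<in> A"
  shows "(AE p in X \<Otimes>\<^sub>M Y. p \<in> A) \<or> (AE p in X \<Otimes>\<^sub>M Y. p \<notin> A)"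
proof -
  interpret X: prob_space X unfolding X_def by (rule prob_space_PiM) (rule assms)
  interpret Y: prob_space Y unfolding Y_def by (rule prob_space_PiM) (rule assms)
  interpret P: pair_prob_space X Y ..
  interpret PP: pair_prob_space "X \<Otimes>\<^sub>M Y" "X \<Otimes>\<^sub>M Y" ..
  let ?P = "X \<Otimes>\<^sub>M Y"
  obtain B N0 N' where B: "A = B \<union> N0" "N0 \<subseteq> N'" "N' \<in> null_sets ?P" "B \<in> sets ?P"
    using A by (rule sets_completionE)
  have "AE p in ?P. p \<notin> N'" using B(3) by (rule AE_not_in)
  then have AB: "AE p in ?P. p \<in> A \<longleftrightarrow> p \<in> B"
    by eventually_elim (use B in auto)
  with G have good: "AE p in ?P. G p \<and> (p \<in> A \<longleftrightarrow> p \<in> B)" by eventually_elim simp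
  note cyl = sets_pair_PiM_eq_sigma_cylinders[where M = M and N = N, folded X_def Y_def]
  have "emeasure ?P B = 0 \<or> emeasure ?P B = 1"
  proof (rule P.zero_one_law_by_resampling[OF cyl B(4)])
    fix D assume "D \<in> {a \<times> b |a b. a \<in> prod_algebra (UNIV :: nat set) (\<lambda>_. M) \<and> b \<in> prod_algebra (UNIV :: nat set) (\<lambda>_. N)}"
    then obtain a b where D: "D = a \<times> b" and a: "a \<in> prod_algebra (UNIV :: nat set) (\<lambda>_. M)"
      and b: "b \<in> prod_algebra (UNIV :: nat set) (\<lambda>_. N)" by blast
    obtain m1 where m1: "\<And>n x x'. m1 \<le> n \<Longrightarrow> x \<in> space X \<Longrightarrow> x' \<in> space X \<Longrightarrow> comb_seq n x x' \<in> a \<longleftrightarrow> x \<in> a"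
      using prod_algebra_initial_segment[OF a] unfolding X_def by metis
    obtain m2 where m2: "\<And>n y y'. m2 \<le> n \<Longrightarrow> y \<in> space Y \<Longrightarrow> y' \<in> space Y \<Longrightarrow> comb_seq n y y' \<in> b \<longleftrightarrow> y \<in> b"
      using prod_algebra_initial_segment[OF b] unfolding Y_def by metis
    define m where "m = max m1 m2"
    define T where "T = (\<lambda>(p :: (nat \<Rightarrow> 'a) \<times> (nat \<Rightarrow> 'b), q :: (nat \<Rightarrow> 'a) \<times> (nat \<Rightarrow> 'b)).
      (comb_seq m (fst p) (fst q), comb_seq m (snd p) (snd q)))"
    have T [measurable]: "T \<in> ?P \<Otimes>\<^sub>M ?P \<rightarrow>\<^sub>M ?P"
      unfolding T_def X_def Y_def split_beta' by measurable
    have distr: "distr (?P \<Otimes>\<^sub>M ?P) ?P T = ?P"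
      unfolding T_def X_def Y_def by (rule distr_resample_initial_segment) fact+
    have "AE z in ?P \<Otimes>\<^sub>M ?P. G (T z) \<and> (T z \<in> A \<longleftrightarrow> T z \<in> B)"
      using AE_distrD[OF T, of "\<lambda>p. G p \<and> (p \<in> A \<longleftrightarrow> p \<in> B)"] good unfolding distr by blast
    then have nested: "AE p in ?P. AE q in ?P. G (T (p, q)) \<and> (T (p, q) \<in> A \<longleftrightarrow> T (p, q) \<in> B)"
      by (rule PP.AE_pair)
    have "\<exists>p0. AE q in ?P. G (T (p0, q))"
    proof (rule ccontr)
      assume *: "\<not> ?thesis"
      have "AE p in ?P. False" using nested
      proof eventually_elim
        case (elim p)
        then have "AE q in ?P. G (T (p, q))" by eventually_elim simp
        with * show ?case by blast
      qed
      then show False by simp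
    qed
    then obtain p0 where p0: "AE q in ?P. G (T (p0, q))" by blast
    \<comment> \<open>The initial segment is irrelevant for \<open>A\<close>, so one typical segment can be used throughout.\<close>
    define h where "h q \<longleftrightarrow> T (p0, q) \<in> A" for q
    have "AE p in ?P. AE q in ?P. T (p, q) \<in> B \<longleftrightarrow> h q"
      using nested
    proof eventually_elim
      case (elim p)
      with p0 show ?case
      proof eventually_elim
        case (elim q)
        have "T (p, q) \<in> A \<longleftrightarrow> T (p0, q) \<in> A"
        proof (rule insensitive[where m = m])
          fix j assume "m \<le> j"
          then show "fst (T (p, q)) j = fst (T (p0, q)) j \<and> snd (T (p, q)) j = snd (T (p0, q)) j"
            by (simp add: T_def comb_seq_def)
        qed (use elim in auto)
        with elim show ?case by (simp add: h_def)
      qed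
    qed
    moreover have "\<forall>p\<in>space ?P. \<forall>q\<in>space ?P. T (p, q) \<in> D \<longleftrightarrow> p \<in> D"
      using m1[of m] m2[of m] by (auto simp: T_def D m_def space_pair_measure)
    ultimately show "\<exists>T h. T \<in> ?P \<Otimes>\<^sub>M ?P \<rightarrow>\<^sub>M ?P \<and> distr (?P \<Otimes>\<^sub>M ?P) ?P T = ?P \<and>
      (\<forall>\<omega>\<in>space ?P. \<forall>\<omega>'\<in>space ?P. T (\<omega>, \<omega>') \<in> D \<longleftrightarrow> \<omega> \<in> D) \<and>
      (AE \<omega> in ?P. AE \<omega>' in ?P. T (\<omega>, \<omega>') \<in> B \<longleftrightarrow> h \<omega>')"
      using T distr by blast
  qed
  then show ?thesis
  proof
    assume "emeasure ?P B = 0"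
    then have "AE p in ?P. p \<notin> B" using B(4) by (intro AE_not_in) (auto simp: null_sets_def)
    with AB have "AE p in ?P. p \<notin> A" by eventually_elim simp
    then show ?thesis ..
  next
    assume "emeasure ?P B = 1"
    then have "AE p in ?P. p \<in> B" using B(4) by (intro P.AE_prob_1) (simp add: P.emeasure_eq_measure)
    with AB have "AE p in ?P. p \<in> A" by eventually_elim simp
    then show ?thesis ..
  qed
qed

text \<open>The value is described by the set \<open>K\<close> of rational levels that bound \<open>F\<close> almost surely: almost every
  point has \<open>K\<close> as its set of rational upper bounds, and extended reals with the same rational upper
  bounds are equal.  Naming the constant as a value at a point of \<open>G\<close> transfers bounds from \<open>F\<close> to it.\<close>

lemma zero_one_law_finitely_insensitive_function:
  fixes M :: "'a measure" and N :: "'b measure" and F :: "(nat \<Rightarrow> 'a) \<times> (nat \<Rightarrow> 'b) \<Rightarrow> ereal"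
  defines "X \<equiv> \<Pi>\<^sub>M i\<in>(UNIV :: nat set). M" and "Y \<equiv> \<Pi>\<^sub>M i\<in>(UNIV :: nat set). N"
  assumes prob: "prob_space M" "prob_space N"
    and F: "F \<in> borel_measurable (completion (X \<Otimes>\<^sub>M Y))"
    and G: "AE p in X \<Otimes>\<^sub>M Y. G p"
    and insensitive: "\<And>p q m. G p \<Longrightarrow> G q \<Longrightarrow> (\<And>j. m \<le> j \<Longrightarrow> fst p j = fst q j \<and> snd p j = snd q j) \<Longrightarrow>
      F p = F q"
  shows "\<exists>p0. G p0 \<and> (AE p in X \<Otimes>\<^sub>M Y. F p = F p0)"
proof -
  interpret X: prob_space X unfolding X_def by (rule prob_space_PiM) (rule assms)
  interpret Y: prob_space Y unfolding Y_def by (rule prob_space_PiM) (rule assms)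
  interpret P: pair_prob_space X Y ..
  let ?P = "X \<Otimes>\<^sub>M Y"
  have G': "AE p in ?P. p \<in> space ?P \<and> G p"
    using AE_space G by eventually_elim simp
  define K where "K = {r :: rat. AE p in ?P. F p \<le> ereal (of_rat r)}"
  have dichotomy: "AE p in ?P. F p \<le> ereal (of_rat r) \<longleftrightarrow> r \<in> K" for r
  proof -
    let ?A = "{p \<in> space ?P. F p \<le> ereal (of_rat r)}"
    have "?A \<in> sets (completion ?P)"
      using borel_measurable_le[OF F borel_measurable_const, of "ereal (of_rat r)"] by simp
    then have "(AE p in ?P. p \<in> ?A) \<or> (AE p in ?P. p \<notin> ?A)"
    proof (rule zero_one_law_finitely_insensitive_event[where M = M and N = N, folded X_def Y_def, OF prob _ G'])
      fix p q m
      assume "p \<in> space ?P \<and> G p" "q \<in> space ?P \<and> G q"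
        and "\<And>j. m \<le> j \<Longrightarrow> fst p j = fst q j \<and> snd p j = snd q j"
      then show "p \<in> ?A \<longleftrightarrow> q \<in> ?A"
        using insensitive[of p q m] by simp
    qed
    then show ?thesis
    proof
      assume "AE p in ?P. p \<in> ?A"
      then have *: "AE p in ?P. F p \<le> ereal (of_rat r)" by eventually_elim simp
      then have "r \<in> K" by (simp add: K_def)
      with * show ?thesis by simp
    next
      assume "AE p in ?P. p \<notin> ?A"
      then have *: "AE p in ?P. \<not> F p \<le> ereal (of_rat r)"
        using AE_space by eventually_elim simp
      have "r \<notin> K"
      proof
        assume "r \<in> K"
        then have "AE p in ?P. F p \<le> ereal (of_rat r)" by (simp add: K_def)
        with * have "AE p in ?P. False" by eventually_elim simp
        then show False by simp
      qed
      with * show ?thesis by simp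
    qed
  qed
  then have all: "AE p in ?P. \<forall>r. F p \<le> ereal (of_rat r) \<longleftrightarrow> r \<in> K"
    by (simp add: AE_all_countable)
  have "\<exists>p0. G p0 \<and> (\<forall>r. F p0 \<le> ereal (of_rat r) \<longleftrightarrow> r \<in> K)"
  proof (rule ccontr)
    assume none: "\<not> ?thesis"
    from G all have "AE p in ?P. False"
      by eventually_elim (use none in blast)
    then show False by simp
  qed
  then obtain p0 where p0: "G p0" "\<And>r. F p0 \<le> ereal (of_rat r) \<longleftrightarrow> r \<in> K" by blast
  have "AE p in ?P. F p = F p0"
    using all
  proof eventually_elim
    case (elim p)
    then have same: "F p \<le> ereal (of_rat r) \<longleftrightarrow> F p0 \<le> ereal (of_rat r)" for r
      using p0(2) by simp
    show ?case
    proof (rule ccontr)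
      assume "F p \<noteq> F p0"
      then consider "F p < F p0" | "F p0 < F p" by fastforce
      then show False
      proof cases
        case 1
        then obtain r where "F p < ereal (of_rat r)" "ereal (of_rat r) < F p0"
          using ereal_dense3 by blast
        then show False using same[of r] by (meson leD less_imp_le)
      next
        case 2
        then obtain r where "F p0 < ereal (of_rat r)" "ereal (of_rat r) < F p"
          using ereal_dense3 by blast
        then show False using same[of r] by (meson leD less_imp_le)
      qed
    qed
  qed
  with p0(1) show ?thesis by blast
qed

section \<open>Linear growth of sums of exponential variables\<close>

lemma nn_integral_exp_minus_exponential:
  "(\<integral>\<^sup>+ x. ennreal (exp (- x)) \<partial>density lborel (exponential_density 1)) = ennreal (1 / 2)"
proof -
  interpret prob_space "density lborel (exponential_density 2)"
    by (rule prob_space_exponential_density) simp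
  have "(\<integral>\<^sup>+ x. ennreal (exp (- x)) \<partial>density lborel (exponential_density 1))
      = (\<integral>\<^sup>+ x. ennreal (exponential_density 1 x) * ennreal (exp (- x)) \<partial>lborel)"
    by (rule nn_integral_density) measurable
  also have "\<dots> = (\<integral>\<^sup>+ x. ennreal (1 / 2) * ennreal (exponential_density 2 x) \<partial>lborel)"
  proof (rule nn_integral_cong)
    fix x :: real
    have "exponential_density 1 x * exp (- x) = 1 / 2 * exponential_density 2 x"
      by (simp add: exponential_density_def exp_add[symmetric])
    then have "ennreal (exponential_density 1 x * exp (- x)) = ennreal (1 / 2 * exponential_density 2 x)"
      by (rule arg_cong)
    then show "ennreal (exponential_density 1 x) * ennreal (exp (- x)) = ennreal (1 / 2) * ennreal (exponential_density 2 x)"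
      by (subst (1 2) ennreal_mult'[symmetric]) (simp_all add: exponential_density_def)
  qed
  also have "\<dots> = ennreal (1 / 2) * (\<integral>\<^sup>+ x. ennreal (exponential_density 2 x) \<partial>lborel)"
    by (rule nn_integral_cmult) measurable
  also have "(\<integral>\<^sup>+ x. ennreal (exponential_density 2 x) \<partial>lborel) = 1"
    using emeasure_space_1 by (simp add: emeasure_density)
  finally show ?thesis by simp
qed

text \<open>Since \<open>E exp (- \<zeta>) = 1/2\<close>, the exponential Markov inequality bounds the probability that the sum of
  \<open>j + 1\<close> terms stays below \<open>(j + 1) / 2\<close> by \<open>(sqrt e / 2) ^ (j + 1)\<close>, which is summable because
  \<open>e < 4\<close>; the first Borel-Cantelli lemma concludes.\<close>

lemma AE_exponential_partial_sums_grow: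
  "AE t in \<Pi>\<^sub>M i\<in>(UNIV :: nat set). density lborel (exponential_density 1).
     \<forall>\<^sub>F j in sequentially. real (Suc j) / 2 \<le> (\<Sum>i\<le>j. t i)"
proof -
  define N where "N = density lborel (exponential_density 1)"
  define R where "R = (\<Pi>\<^sub>M i\<in>(UNIV :: nat set). N)"
  interpret N: prob_space N
    unfolding N_def by (rule prob_space_exponential_density) simp
  interpret R: prob_space R
    unfolding R_def by (rule prob_space_PiM) (rule N.prob_space_axioms)
  have sets_N [measurable_cong]: "sets N = sets borel" by (simp add: N_def)
  have exp_N: "(\<lambda>x. ennreal (exp (- x))) \<in> borel_measurable N" by measurable
  have comp [measurable]: "(\<lambda>t. t i) \<in> R \<rightarrow>\<^sub>M N" for i
    unfolding R_def by simp
  have comp_borel [measurable]: "(\<lambda>t. t i) \<in> borel_measurable R" for i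
    using comp[of i] sets_N by (simp cong: measurable_cong_sets)
  have distr_comp: "distr R N (\<lambda>t. t i) = N" for i
    unfolding R_def by (rule distr_PiM_component) (use N.prob_space_axioms in auto)
  have "R.indep_vars (\<lambda>_. N) (\<lambda>i t. t i) UNIV"
    by (subst R.indep_vars_iff_distr_eq_PiM'[where M' = "\<lambda>_. N" and X = "\<lambda>i t. t i" and I = UNIV, OF UNIV_not_empty comp]) (auto simp: distr_comp R_def[symmetric] restrict_UNIV distr_id2)
  then have "R.indep_vars (\<lambda>_. borel) (\<lambda>i t. ennreal (exp (- t i))) UNIV"
    by (rule R.indep_vars_compose2[where M' = "\<lambda>_. N" and X = "\<lambda>i t. t i" and Y = "\<lambda>_ x. ennreal (exp (- x))"]) (rule exp_N)
  note indep = R.indep_vars_subset[OF this]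
  have laplace: "(\<integral>\<^sup>+ t. ennreal (exp (- (\<Sum>i\<le>j. t i))) \<partial>R) = ennreal ((1 / 2) ^ Suc j)" for j
  proof -
    have single: "(\<integral>\<^sup>+ t. ennreal (exp (- t i)) \<partial>R) = ennreal (1 / 2)" for i
    proof -
      have "(\<integral>\<^sup>+ t. ennreal (exp (- t i)) \<partial>R) = (\<integral>\<^sup>+ x. ennreal (exp (- x)) \<partial>distr R N (\<lambda>t. t i))"
        by (rule nn_integral_distr[symmetric, OF comp]) (simp only: distr_comp exp_N)
      then show ?thesis
        unfolding distr_comp unfolding N_def nn_integral_exp_minus_exponential .
    qed
    have "(\<integral>\<^sup>+ t. ennreal (exp (- (\<Sum>i\<le>j. t i))) \<partial>R) = (\<integral>\<^sup>+ t. (\<Prod>i\<le>j. ennreal (exp (- t i))) \<partial>R)"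
      by (intro nn_integral_cong) (simp add: prod_ennreal exp_sum sum_negf[symmetric])
    also have "\<dots> = (\<Prod>i\<le>j. \<integral>\<^sup>+ t. ennreal (exp (- t i)) \<partial>R)"
      by (rule R.indep_vars_nn_integral) (use indep in auto)
    also have "\<dots> = (\<Prod>i\<le>j. ennreal (1 / 2))"
      by (simp only: single)
    also have "\<dots> = ennreal (\<Prod>i\<le>j. 1 / 2)"
      by (rule prod_ennreal) simp
    finally show ?thesis by simp
  qed
  define L where "L j = {t \<in> space R. (\<Sum>i\<le>j. t i) < real (Suc j) / 2}" for j
  have [measurable]: "L j \<in> sets R" for j
    unfolding L_def by measurable
  have bound: "measure R (L j) \<le> (exp (1 / 2) / 2) ^ Suc j" for j
  proof -
    have "emeasure R (L j) \<le> emeasure R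
        {t \<in> space R. 1 \<le> ennreal (exp (real (Suc j) / 2)) * ennreal (exp (- (\<Sum>i\<le>j. t i)))}"
    proof (rule emeasure_mono)
      show "L j \<subseteq> {t \<in> space R. 1 \<le> ennreal (exp (real (Suc j) / 2)) * ennreal (exp (- (\<Sum>i\<le>j. t i)))}"
      proof
        fix t assume t: "t \<in> L j"
        then have "1 \<le> exp (real (Suc j) / 2 + - (\<Sum>i\<le>j. t i))"
          by (simp add: L_def)
        then have "1 \<le> ennreal (exp (real (Suc j) / 2) * exp (- (\<Sum>i\<le>j. t i)))"
          unfolding exp_add by (metis ennreal_1 ennreal_leI)
        with t show "t \<in> {t \<in> space R. 1 \<le> ennreal (exp (real (Suc j) / 2)) * ennreal (exp (- (\<Sum>i\<le>j. t i)))}"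
          by (simp add: L_def ennreal_mult')
      qed
    qed measurable
    also have "\<dots> \<le> ennreal (exp (real (Suc j) / 2)) * (\<integral>\<^sup>+ t. ennreal (exp (- (\<Sum>i\<le>j. t i))) * indicator (space R) t \<partial>R)"
      by (rule nn_integral_Markov_inequality) measurable
    also have "(\<integral>\<^sup>+ t. ennreal (exp (- (\<Sum>i\<le>j. t i))) * indicator (space R) t \<partial>R) = ennreal ((1 / 2) ^ Suc j)"
      unfolding laplace[symmetric] by (intro nn_integral_cong) simp
    also have "ennreal (exp (real (Suc j) / 2)) * ennreal ((1 / 2) ^ Suc j) = ennreal ((exp (1 / 2) / 2) ^ Suc j)"
    proof -
      have "exp (real (Suc j) / 2) = exp (1 / 2 :: real) ^ Suc j"
        by (subst exp_of_nat_mult[symmetric]) simp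
      then show ?thesis
        by (simp add: ennreal_mult'[symmetric] power_divide del: power_Suc)
    qed
    finally show ?thesis
      by (simp add: R.emeasure_eq_measure del: power_Suc)
  qed
  have "exp (1 / 2 :: real) / 2 < 1"
  proof -
    have "exp (1 / 2 :: real) ^ 2 = exp 1" by (simp add: exp_of_nat_mult[symmetric])
    also have "\<dots> < 2 ^ 2" using e_less_272 by simp
    finally show ?thesis using power_less_imp_less_base[of "exp (1 / 2 :: real)" 2 2] by simp
  qed
  then have "summable (\<lambda>j. (exp (1 / 2 :: real) / 2) ^ Suc j)"
    by (simp add: summable_mult summable_geometric)
  then have "summable (\<lambda>j. measure R (L j))"
    by (rule summable_comparison_test'[of _ 0]) (use bound in auto)
  then have "AE t in R. \<forall>\<^sub>F j in sequentially. t \<in> space R - L j"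
    by (intro borel_cantelli_AE1) (auto simp: R.emeasure_eq_measure)
  then have "AE t in R. \<forall>\<^sub>F j in sequentially. real (Suc j) / 2 \<le> (\<Sum>i\<le>j. t i)"
    by eventually_elim (auto elim!: eventually_mono simp: L_def not_less)
  then show ?thesis unfolding R_def N_def .
qed

section \<open>The law of the driving sequences\<close>

lemma distr_pair_snd:
  assumes "prob_space M" "sigma_finite_measure N"
  shows "distr (M \<Otimes>\<^sub>M N) N snd = N"
proof (rule measure_eqI)
  interpret M: prob_space M by fact
  interpret N: sigma_finite_measure N by fact
  fix A assume "A \<in> sets (distr (M \<Otimes>\<^sub>M N) N snd)"
  then have A: "A \<in> sets N" by simp
  then have "emeasure (distr (M \<Otimes>\<^sub>M N) N snd) A = emeasure (M \<Otimes>\<^sub>M N) (space M \<times> A)"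
    by (auto simp: emeasure_distr space_pair_measure dest: sets.sets_into_space intro!: arg_cong2[where f = emeasure])
  also have "\<dots> = emeasure N A"
    using A by (simp add: N.emeasure_pair_measure_Times M.emeasure_space_1)
  finally show "emeasure (distr (M \<Otimes>\<^sub>M N) N snd) A = emeasure N A" .
qed simp

text \<open>Each sequence is independent and identically distributed, so its law is a product; the joint law is
  identified on rectangles, where the independence of the two sequences factorizes it.\<close>

lemma driving_sequences_distr:
  assumes "prob_space Q" and driving: "driving_sequences S Q V \<zeta>"
  shows "(\<lambda>\<omega>. (\<lambda>j. V j \<omega>, \<lambda>j. \<zeta> j \<omega>)) \<in> Q \<rightarrow>\<^sub>M driving_law S"
    and "distr Q (driving_law S) (\<lambda>\<omega>. (\<lambda>j. V j \<omega>, \<lambda>j. \<zeta> j \<omega>)) = driving_law S"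
proof -
  interpret Q: prob_space Q by fact
  let ?X = "\<Pi>\<^sub>M j\<in>(UNIV :: nat set). S" and ?Y = "\<Pi>\<^sub>M j\<in>(UNIV :: nat set). (borel :: real measure)"
  let ?V = "\<lambda>\<omega> j. V j \<omega>" and ?Z = "\<lambda>\<omega> j. \<zeta> j \<omega>"
  have V: "Q.indep_vars (\<lambda>_. S) V UNIV" and V_law: "\<And>j. distr Q S (V j) = uniform_measure S (space S)"
    and Z: "Q.indep_vars (\<lambda>_. borel) \<zeta> UNIV"
    and Z_law: "\<And>j. distributed Q lborel (\<zeta> j) (exponential_density 1)"
    and indep: "Q.indep_set {?V -` A \<inter> space Q |A. A \<in> sets ?X} {?Z -` B \<inter> space Q |B. B \<in> sets ?Y}"
    using driving unfolding driving_sequences_def by auto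
  have component [measurable]: "V j \<in> Q \<rightarrow>\<^sub>M S" "\<zeta> j \<in> borel_measurable Q" for j
    using V Z unfolding Q.indep_vars_def by auto
  have V_meas: "?V \<in> Q \<rightarrow>\<^sub>M ?X" and Z_meas: "?Z \<in> Q \<rightarrow>\<^sub>M ?Y"
    by (auto intro!: measurable_PiM_single' measurable_space[OF component(1)] simp: space_PiM)
  let ?U = "\<Pi>\<^sub>M j\<in>(UNIV :: nat set). uniform_measure S (space S)"
    and ?E = "\<Pi>\<^sub>M j\<in>(UNIV :: nat set). density lborel (exponential_density 1)"
  have V_distr: "distr Q ?X ?V = ?U"
    using V by (subst (asm) Q.indep_vars_iff_distr_eq_PiM') (auto simp: V_law restrict_UNIV)
  have "distr Q borel (\<zeta> j) = density lborel (exponential_density 1)" for j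
  proof -
    have "distr Q borel (\<zeta> j) = distr Q lborel (\<zeta> j)" by (rule distr_cong) auto
    also have "\<dots> = density lborel (exponential_density 1)"
      using Z_law by (simp add: distributed_distr_eq_density)
    finally show ?thesis .
  qed
  then have Z_distr: "distr Q ?Y ?Z = ?E"
    using Z by (subst (asm) Q.indep_vars_iff_distr_eq_PiM') (auto simp: restrict_UNIV)
  have sets: "sets ?U = sets ?X" "sets ?E = sets ?Y"
    unfolding V_distr[symmetric] Z_distr[symmetric] by simp_all
  have T: "(\<lambda>\<omega>. (?V \<omega>, ?Z \<omega>)) \<in> Q \<rightarrow>\<^sub>M ?U \<Otimes>\<^sub>M ?E"
    using V_meas Z_meas by (intro measurable_Pair) (simp_all cong: measurable_cong_sets add: sets)
  then show "(\<lambda>\<omega>. (?V \<omega>, ?Z \<omega>)) \<in> Q \<rightarrow>\<^sub>M driving_law S"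
    unfolding driving_law_def .
  interpret U: prob_space ?U
    unfolding V_distr[symmetric] by (rule Q.prob_space_distr[OF V_meas])
  interpret E: prob_space ?E
    unfolding Z_distr[symmetric] by (rule Q.prob_space_distr[OF Z_meas])
  have "?U \<Otimes>\<^sub>M ?E = distr Q (?U \<Otimes>\<^sub>M ?E) (\<lambda>\<omega>. (?V \<omega>, ?Z \<omega>))"
  proof (rule pair_measure_eqI)
    fix A B assume A: "A \<in> sets ?U" and B: "B \<in> sets ?E"
    have "emeasure (distr Q (?U \<Otimes>\<^sub>M ?E) (\<lambda>\<omega>. (?V \<omega>, ?Z \<omega>))) (A \<times> B)
        = emeasure Q ((\<lambda>\<omega>. (?V \<omega>, ?Z \<omega>)) -` (A \<times> B) \<inter> space Q)"
      by (rule emeasure_distr[OF T pair_measureI[OF A B]])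
    also have "(\<lambda>\<omega>. (?V \<omega>, ?Z \<omega>)) -` (A \<times> B) \<inter> space Q = (?V -` A \<inter> space Q) \<inter> (?Z -` B \<inter> space Q)"
      by auto
    also have "emeasure Q \<dots> = emeasure Q (?V -` A \<inter> space Q) * emeasure Q (?Z -` B \<inter> space Q)"
    proof -
      have "Q.prob ((?V -` A \<inter> space Q) \<inter> (?Z -` B \<inter> space Q))
          = Q.prob (?V -` A \<inter> space Q) * Q.prob (?Z -` B \<inter> space Q)"
        using A B unfolding sets by (intro Q.indep_setD[OF indep]) blast+
      then show ?thesis by (simp add: Q.emeasure_eq_measure ennreal_mult')
    qed
    also have "emeasure Q (?V -` A \<inter> space Q) = emeasure ?U A"
      using emeasure_distr[OF V_meas, of A] A unfolding V_distr sets by simp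
    also have "emeasure Q (?Z -` B \<inter> space Q) = emeasure ?E B"
      using emeasure_distr[OF Z_meas, of B] B unfolding Z_distr sets by simp
    finally show "emeasure ?U A * emeasure ?E B
        = emeasure (distr Q (?U \<Otimes>\<^sub>M ?E) (\<lambda>\<omega>. (?V \<omega>, ?Z \<omega>))) (A \<times> B)" by simp
  qed (use U.sigma_finite_measure_axioms E.sigma_finite_measure_axioms in simp_all)
  then show "distr Q (driving_law S) (\<lambda>\<omega>. (?V \<omega>, ?Z \<omega>)) = driving_law S"
    unfolding driving_law_def by simp
qed

section \<open>Limits of the normalized entropy numbers\<close>

theorem proposition4p1:
  fixes \<alpha> :: real
    and S :: "'s measure"
    and u :: "'e::banach \<Rightarrow> 's \<Rightarrow> real"
    and \<phi> :: "'s \<Rightarrow> 'e \<Rightarrow>\<^sub>L real"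
    and Q :: "'d measure"
    and V :: "nat \<Rightarrow> 'd \<Rightarrow> 's"
    and \<zeta> :: "nat \<Rightarrow> 'd \<Rightarrow> real"
    and v :: "'d \<Rightarrow> 'e \<Rightarrow> ell2"
    and a :: "nat \<Rightarrow> real"
  assumes "0 < \<alpha>" "\<alpha> < 2"
    and "finite_measure S"
    and "L_alpha_operator \<alpha> S u"
    and "decomposed_by \<alpha> S u \<phi>"
    and "\<And>s. s \<in> space S \<Longrightarrow> norm (\<phi> s) \<le> 1"
    and "prob_space Q"
    and "driving_sequences S Q V \<zeta>"
    and "\<And>\<omega>. v \<omega> = random_operator \<alpha> S u (\<lambda>j. V j \<omega>) (\<lambda>j. \<zeta> j \<omega>)"
    and "measurable_entropy_numbers \<alpha> S u"
    and "\<And>n. 0 < a n"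
    and "regularly_varying a"
  shows "(\<exists>C::ereal. 0 \<le> C \<and>
           (AE \<omega> in Q. limsup (\<lambda>n. ereal (a n * entropy_number n (v \<omega>))) = C)) \<and>
         (\<exists>C'::ereal. 0 \<le> C' \<and>
           (AE \<omega> in Q. liminf (\<lambda>n. ereal (a n * entropy_number n (v \<omega>))) = C'))"
proof -
  interpret Q: prob_space Q by fact
  let ?M = "uniform_measure S (space S)" and ?N = "density lborel (exponential_density 1)"
  define e where "e p n = ereal (a n * entropy_number n (random_operator \<alpha> S u (fst p) (snd p)))" for p n
  define G where "G p \<longleftrightarrow> (\<forall>j. fst p j \<in> space S) \<and> linear_growth (snd p)" for p :: "(nat \<Rightarrow> 's) \<times> (nat \<Rightarrow> real)"
  have "prob_space (distr Q S (V 0))"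
    using assms(8) unfolding driving_sequences_def Q.indep_vars_def by (intro Q.prob_space_distr) auto
  then have M: "prob_space ?M"
    using assms(8) unfolding driving_sequences_def by simp
  have N: "prob_space ?N"
    by (rule prob_space_exponential_density) simp
  interpret X: prob_space "\<Pi>\<^sub>M j\<in>(UNIV :: nat set). ?M" by (rule prob_space_PiM) (rule M)
  interpret Y: prob_space "\<Pi>\<^sub>M j\<in>(UNIV :: nat set). ?N" by (rule prob_space_PiM) (rule N)
  interpret P: pair_prob_space "\<Pi>\<^sub>M j\<in>(UNIV :: nat set). ?M" "\<Pi>\<^sub>M j\<in>(UNIV :: nat set). ?N" ..
  have u: "\<bar>u z s\<bar> \<le> 1" if "norm z \<le> 1" "s \<in> space S" for z s
  proof -
    have "\<bar>u z s\<bar> \<le> norm (\<phi> s) * norm z"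
      using assms(5) that(2) norm_blinfun[of "\<phi> s" z] unfolding decomposed_by_def by simp
    also have "\<dots> \<le> 1 * 1" using assms(6)[OF that(2)] that(1) by (intro mult_mono) auto
    finally show ?thesis by simp
  qed
  have good: "AE p in driving_law S. G p"
  proof -
    have "AE p in driving_law S. linear_growth (snd p)"
      unfolding driving_law_def
      by (rule AE_distrD[OF measurable_snd, of "\<lambda>t. linear_growth t"],
          unfold distr_pair_snd[OF X.prob_space_axioms Y.sigma_finite_measure_axioms] linear_growth_def)
         (rule AE_exponential_partial_sums_grow)
    then show ?thesis
      using AE_space
      by eventually_elim (auto simp: G_def driving_law_def space_pair_measure space_PiM)
  qed
  have e_measurable: "(\<lambda>p. e p n) \<in> borel_measurable (completion (driving_law S))" for n
  proof -
    \<comment> \<open>Measurability is known for positive indices; truncated subtraction makes index \<open>0\<close> a copy of \<open>1\<close>.\<close>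
    have "entropy_number 0 w = entropy_number 1 w" for w :: "'e \<Rightarrow> ell2"
      by (simp add: entropy_number_def)
    then have "(\<lambda>p. entropy_number n (random_operator \<alpha> S u (fst p) (snd p)))
        \<in> borel_measurable (completion (driving_law S))"
      using assms(10) unfolding measurable_entropy_numbers_def split_beta'
      by (cases "n = 0") auto
    then show ?thesis unfolding e_def by measurable
  qed
  have le: "limsup (e q) \<le> limsup (e p)" "liminf (e q) \<le> liminf (e p)"
    if "G p" "G q" "\<And>j. m \<le> j \<Longrightarrow> fst p j = fst q j \<and> snd p j = snd q j" for p q m
  proof -
    have G: "\<And>j. fst p j \<in> space S" "linear_growth (snd p)" "\<And>j. fst q j \<in> space S" "linear_growth (snd q)"
      using that(1,2) unfolding G_def by blast+
    have u_p: "\<bar>u z (fst p j)\<bar> \<le> 1" if "norm z \<le> 1" for z j using u[OF that G(1)] .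
    have u_q: "\<bar>u z (fst q j)\<bar> \<le> 1" if "norm z \<le> 1" for z j using u[OF that G(3)] .
    note tail_le = limsup_liminf_entropy_numbers_tail_le[where S = S and u = u and x = "fst p" and x' = "fst q"
        and m = m, OF assms(1,2) G(2,4) u_p u_q that(3) assms(11,12)]
    show "limsup (e q) \<le> limsup (e p)"
      unfolding e_def by (rule tail_le(1))
    show "liminf (e q) \<le> liminf (e p)"
      unfolding e_def by (rule tail_le(2))
  qed
  have nonneg: "0 \<le> e p n" if "G p" for p n
  proof -
    obtain R where R: "\<And>z. norm z \<le> 1 \<Longrightarrow> norm (random_operator \<alpha> S u (fst p) (snd p) z) \<le> R"
      using random_operator_bounded[of \<alpha> "snd p" u "fst p" S] u assms(1,2) \<open>G p\<close> unfolding G_def by blast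
    then show ?thesis
      unfolding e_def using entropy_number_nonneg[where w = "random_operator \<alpha> S u (fst p) (snd p)", OF R] assms(11)[of n] by (simp add: less_imp_le)
  qed
  have transfer: "AE \<omega> in Q. P (\<lambda>j. V j \<omega>, \<lambda>j. \<zeta> j \<omega>)" if "AE p in driving_law S. P p" for P
    using AE_distrD[OF driving_sequences_distr(1)[OF assms(7,8)], of P] that
    unfolding driving_sequences_distr(2)[OF assms(7,8)] .
  have almost_surely_const: "\<exists>C. 0 \<le> C \<and> (AE \<omega> in Q. L (e (\<lambda>j. V j \<omega>, \<lambda>j. \<zeta> j \<omega>)) = C)"
    if L: "(\<lambda>p. L (e p)) \<in> borel_measurable (completion (driving_law S))"
      and le: "\<And>p q m. G p \<Longrightarrow> G q \<Longrightarrow> (\<And>j. m \<le> j \<Longrightarrow> fst p j = fst q j \<and> snd p j = snd q j) \<Longrightarrow> L (e q) \<le> L (e p)"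
      and nonneg: "\<And>p. G p \<Longrightarrow> 0 \<le> L (e p)" for L :: "(nat \<Rightarrow> ereal) \<Rightarrow> ereal"
  proof -
    have eq: "L (e p) = L (e q)"
      if "G p" "G q" "\<And>j. m \<le> j \<Longrightarrow> fst p j = fst q j \<and> snd p j = snd q j" for p q m
      using le[of p q m] le[of q p m] that by (simp add: antisym)
    have "\<exists>p0. G p0 \<and> (AE p in driving_law S. L (e p) = L (e p0))"
      unfolding driving_law_def
    proof (rule zero_one_law_finitely_insensitive_function[OF M N L[unfolded driving_law_def] good[unfolded driving_law_def]])
      fix p q m
      assume "G p" "G q" "\<And>j. m \<le> j \<Longrightarrow> fst p j = fst q j \<and> snd p j = snd q j"
      then show "L (e p) = L (e q)" by (rule eq)
    qed
    then obtain p0 where "G p0" "AE p in driving_law S. L (e p) = L (e p0)" by blast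
    then show ?thesis using transfer[of "\<lambda>p. L (e p) = L (e p0)"] nonneg by blast
  qed
  have "\<exists>C. 0 \<le> C \<and> (AE \<omega> in Q. limsup (e (\<lambda>j. V j \<omega>, \<lambda>j. \<zeta> j \<omega>)) = C)"
  proof (rule almost_surely_const)
    show "(\<lambda>p. limsup (e p)) \<in> borel_measurable (completion (driving_law S))"
      by (intro borel_measurable_limsup e_measurable)
    show "0 \<le> limsup (e p)" if "G p" for p
      using nonneg[OF that] by (intro le_Limsup) auto
  qed (rule le)
  moreover have "\<exists>C. 0 \<le> C \<and> (AE \<omega> in Q. liminf (e (\<lambda>j. V j \<omega>, \<lambda>j. \<zeta> j \<omega>)) = C)"
  proof (rule almost_surely_const)
    show "(\<lambda>p. liminf (e p)) \<in> borel_measurable (completion (driving_law S))"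
      by (intro borel_measurable_liminf e_measurable)
    show "0 \<le> liminf (e p)" if "G p" for p
      using nonneg[OF that] by (intro Liminf_bounded) auto
  qed (rule le)
  ultimately show ?thesis
    unfolding e_def assms(9) by simp
qed

end
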